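(* Let $p$ be a prime, $G=SL(2,\mathbb{Z}_p)$ and $T=\{F\in SL(2,\mathbb{Z}_p):\mathrm{Tr}(F)\neq 2\pmod p\}$. Then $|T|=|G|-p^2$, and the adjacency matrix of the Cayley graph $\Gamma(G,T)$ has spectrum consisting of the eigenvalues $\lambda_0=p(p^2-1)-p^2$ with multiplicity $1$, $\lambda_1=p$ with multiplicity $p(p-1)^2/2$, $\lambda_2=-1$ with multiplicity $p^2$, and $\lambda_3=-p$ with multiplicity $(p-2)(p+1)^2/2$.
   Context: The Cayley graph $\Gamma(G,T)$ of a finite group $G$ with respect to $T\subset G$ (with $I\notin T$, $T^{-1}=T$) has vertex set $G$ and an edge between $g_1$ and $g_2$ iff $g_1^{-1}g_2\in T$. Its adjacency matrix is the $|G|\times|G|$ 0/1 matrix with entry 1 exactly for adjacent pairs. Traces are taken modulo $p$. *)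

theory Defs
  imports "Jordan_Normal_Form.Char_Poly"
begin

text \<open>Elements of SL(2,Z_p) are represented as quadruples (a,b,c,d) of residues in {0..p-1},
  standing for the matrix [[a,b],[c,d]], with a*d - b*c = 1 (mod p).\<close>

type_synonym m2 = "int \<times> int \<times> int \<times> int"

definition SL2 :: "nat \<Rightarrow> m2 set" where
  "SL2 p = {(a,b,c,d). a \<in> {0..<int p} \<and> b \<in> {0..<int p} \<and> c \<in> {0..<int p} \<and> d \<in> {0..<int p}
      \<and> (a*d - b*c) mod int p = 1 mod int p}"

fun m2_mult :: "nat \<Rightarrow> m2 \<Rightarrow> m2 \<Rightarrow> m2" where
  "m2_mult p (a,b,c,d) (e,f,g,h) =
     ((a*e + b*g) mod int p, (a*f + b*h) mod int p, (c*e + d*g) mod int p, (c*f + d*h) mod int p)"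

text \<open>Inverse in SL(2,Z_p): the adjugate matrix (determinant is 1), reduced mod p.\<close>
fun m2_inv :: "nat \<Rightarrow> m2 \<Rightarrow> m2" where
  "m2_inv p (a,b,c,d) = (d mod int p, (-b) mod int p, (-c) mod int p, a mod int p)"

fun m2_trace :: "m2 \<Rightarrow> int" where
  "m2_trace (a,b,c,d) = a + d"

definition connT :: "nat \<Rightarrow> m2 set" where
  "connT p = {F \<in> SL2 p. m2_trace F mod int p \<noteq> 2 mod int p}"

definition cayley_adj :: "m2 set \<Rightarrow> (m2 \<Rightarrow> m2 \<Rightarrow> m2) \<Rightarrow> (m2 \<Rightarrow> m2) \<Rightarrow> m2 set
    \<Rightarrow> (nat \<Rightarrow> m2) \<Rightarrow> int mat" where
  "cayley_adj G mul iv T e =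
     mat (card G) (card G) (\<lambda>(i,j). if mul (iv (e i)) (e j) \<in> T then 1 else 0)"

end

theory Submission
  imports Defs "Jordan_Normal_Form.Schur_Decomposition"
begin

text \<open>Write the adjacency matrix as \<open>A = J - U\<close>, where \<open>J\<close> is the all-ones matrix and
  \<open>U x y = 1\<close> iff \<open>x\<inverse> y\<close> has trace 2, that is, is unipotent.  Let \<open>P x y\<close> be the number of fixed points
  of \<open>x\<inverse> y\<close> on the projective line over \<open>\<int>\<^sub>p\<close>.  The unipotent matrices are \<open>I + K\<close>, where \<open>K\<close> runs
  through the quadratic cone of nilpotent matrices, and the nonzero points of the cone are the
  \<open>l (-XY, X\<^sup>2, -Y\<^sup>2)\<close> with \<open>l \<noteq> 0\<close> and \<open>(X : Y)\<close> on the projective line.  A linear form on the cone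
  is therefore a multiple \<open>l q(X, Y)\<close> of a binary quadratic form, so plane sections of the cone are
  counted by the projective roots of \<open>q\<close>.  This gives \<open>U\<^sup>2 = p\<^sup>2 I + (p + 1) J - P\<close> and
  \<open>U P = P + (p\<^sup>2 - 1) J\<close>; summing these identities yields \<open>|G| = p\<^sup>3 - p\<close>.  Consequently \<open>A\<close>
  is annihilated by \<open>(x - \<lambda>\<^sub>0)(x\<^sup>2 - p\<^sup>2)(x + 1)\<close>, and the traces of \<open>I, A, A\<^sup>2, A\<^sup>3\<close> determine the
  multiplicities.  (For \<open>p = 2\<close> the values \<open>\<lambda>\<^sub>0\<close> and \<open>p\<close> coincide and the first three traces
  suffice.)\<close>

section \<open>Plane sections of the nilpotent cone\<close>

text \<open>Each projective point is stored as its coordinate pair with first nonzero coordinate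
  \<open>1\<close>, so that counting points is counting pairs.\<close>

definition proj_line :: "int \<Rightarrow> (int \<times> int) set" where
  "proj_line q = insert (0, 1) (Pair 1 ` {0..<q})"

definition form_roots :: "int \<Rightarrow> int \<Rightarrow> int \<Rightarrow> int \<Rightarrow> (int \<times> int) set" where
  "form_roots q A B C = {(X, Y) \<in> proj_line q. q dvd A * X\<^sup>2 + B * X * Y + C * Y\<^sup>2}"

text \<open>The triple \<open>(s, b, c)\<close> stands for the traceless matrix with rows
  \<open>(s, b)\<close> and \<open>(c, - s)\<close>. Its determinant is
  \<open>- (s^2 + b * c)\<close>, and a traceless 2 by 2 matrix of determinant 0 squares to
  0.\<close>

definition nil_cone :: "int \<Rightarrow> (int \<times> int \<times> int) set" where
  "nil_cone q = {(s, b, c). s \<in> {0..<q} \<and> b \<in> {0..<q} \<and> c \<in> {0..<q} \<and> q dvd s\<^sup>2 + b * c}"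

text \<open>This is \<open>l\<close> times the column \<open>(X, Y)\<close> times the row
  \<open>(- Y, X)\<close>: for \<open>l\<close> and \<open>(X, Y)\<close> nonzero modulo
  \<open>q\<close>, a nilpotent matrix whose kernel and image are both spanned by
  \<open>(X, Y)\<close>.\<close>

fun cone_point :: "int \<Rightarrow> int \<times> int \<times> int \<Rightarrow> int \<times> int \<times> int" where
  "cone_point q (l, X, Y) = (- (l * X * Y) mod q, l * X\<^sup>2 mod q, - (l * Y\<^sup>2) mod q)"

section \<open>Arithmetic of residues modulo a prime\<close>

lemma int_card_filter:
  "finite S \<Longrightarrow> int (card {x \<in> S. P x}) = (\<Sum>x\<in>S. of_bool (P x))"
  by (simp add: Int_def)

lemma residue_eq_0: "x \<in> {0..<q} \<Longrightarrow> q dvd x \<Longrightarrow> x = 0" for x q :: int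
  using zdvd_imp_le[of q x] by fastforce

lemma residue_eqI:
  fixes x y q :: int
  assumes "x \<in> {0..<q}" "y \<in> {0..<q}" "q dvd x - y"
  shows "x = y"
proof -
  from assms(3) have "x mod q = y mod q" by (simp add: mod_eq_dvd_iff)
  with assms(1,2) show ?thesis by simp
qed

lemma dvd_cong_diff: "q dvd x - y \<Longrightarrow> q dvd x \<longleftrightarrow> q dvd y" for q x y :: int
  using dvd_diff_commute dvd_add_right_iff by (metis diff_add_cancel)

locale prime_residues =
  fixes q :: int
  assumes prime_q: "prime q"
begin

lemma q_ge_2: "q \<ge> 2"
  using prime_q by (rule prime_ge_2_int)

lemma q_not_dvd_1: "\<not> q dvd 1"
  using q_ge_2 by (auto dest: zdvd_imp_le)

lemma q_dvd_mult_iff: "q dvd a * b \<longleftrightarrow> q dvd a \<or> q dvd b"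
  using prime_q by (rule prime_dvd_mult_iff)

lemma q_dvd_square_iff: "q dvd a\<^sup>2 \<longleftrightarrow> q dvd a"
  by (simp add: power2_eq_square q_dvd_mult_iff)

lemma linear_congruence:
  assumes "\<not> q dvd a"
  shows "\<exists>!y. y \<in> {0..<q} \<and> q dvd a * y - r"
proof (rule ex_ex1I)
  have "coprime q a" using assms prime_q by (simp add: prime_imp_coprime)
  then obtain u v where uv: "u * q + v * a = 1"
    by (metis bezout_int coprime_imp_gcd_eq_1)
  have "a * (v * r) - r = (u * q + v * a - 1) * r - u * q * r" by (simp add: algebra_simps)
  then have "q dvd a * (v * r) - r" by (simp add: uv)
  moreover have "q dvd a * (v * r mod q) - a * (v * r)"
    unfolding mod_eq_dvd_iff[symmetric] by (rule mod_mult_right_eq)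
  ultimately have "q dvd a * (v * r mod q) - r"
    using dvd_add[of q "a * (v * r) - r" "a * (v * r mod q) - a * (v * r)"] by simp
  then show "\<exists>y. y \<in> {0..<q} \<and> q dvd a * y - r"
    using q_ge_2 by (intro exI[of _ "v * r mod q"]) auto
next
  fix y z
  assume y: "y \<in> {0..<q} \<and> q dvd a * y - r" and z: "z \<in> {0..<q} \<and> q dvd a * z - r"
  then have "q dvd (a * y - r) - (a * z - r)" by (blast intro: dvd_diff)
  then have "q dvd a * (y - z)" by (simp add: algebra_simps)
  then have "q dvd y - z" using assms q_dvd_mult_iff by blast
  then show "y = z" using y z residue_eqI by blast
qed

section \<open>Parametrisation of the nilpotent cone by its generators\<close>

lemma finite_proj_line: "finite (proj_line q)"
  by (simp add: proj_line_def)

lemma card_proj_line: "int (card (proj_line q)) = q + 1"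
proof -
  have "card (Pair (1::int) ` {0..<q}) = nat q"
    by (subst card_image) (auto simp: inj_on_def)
  then show ?thesis using q_ge_2 unfolding proj_line_def
    by (subst card_insert_disjoint) auto
qed

lemma finite_nil_cone: "finite (nil_cone q)"
  by (rule finite_subset[of _ "{0..<q} \<times> {0..<q} \<times> {0..<q}"]) (auto simp: nil_cone_def)

lemma proj_line_cases [consumes 1, case_names infinity finite]:
  assumes "v \<in> proj_line q"
  obtains "v = (0, 1)" | y where "v = (1, y)" "y \<in> {0..<q}"
  using assms by (auto simp: proj_line_def)

text \<open>The second coordinate is \<open>0\<close> over the point \<open>(0, 1)\<close> and
  \<open>l\<close> over \<open>(1, y)\<close>, so it separates the two kinds of points; the other
  coordinates then recover \<open>l\<close> and \<open>y\<close>. Conversely, \<open>b = 0\<close>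
  on the cone forces \<open>s = 0\<close>, and otherwise \<open>l = b\<close> and
  \<open>y = - s / b\<close>.\<close>

lemma cone_point_bij:
  "bij_betw (cone_point q) ({1..<q} \<times> proj_line q) (nil_cone q - {(0, 0, 0)})"
proof (rule bij_betw_imageI)
  show "inj_on (cone_point q) ({1..<q} \<times> proj_line q)"
  proof (rule inj_onI)
    fix x x' assume "x \<in> {1..<q} \<times> proj_line q" "x' \<in> {1..<q} \<times> proj_line q"
      and eq: "cone_point q x = cone_point q x'"
    then obtain l v l' v' where x: "x = (l, v)" "x' = (l', v')"
      and l: "l \<in> {1..<q}" "l' \<in> {1..<q}" and v: "v \<in> proj_line q" "v' \<in> proj_line q"
      by blast
    have l0: "\<not> q dvd l" "\<not> q dvd l'" using l by (auto dest: zdvd_imp_le)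
    from v(1) show "x = x'"
    proof (cases rule: proj_line_cases)
      case v_inf: infinity
      from v(2) show ?thesis
      proof (cases rule: proj_line_cases)
        case infinity
        have "(- l) mod q = (- l') mod q" using eq v_inf infinity x by simp
        then have "q dvd l' - l" by (simp add: mod_eq_dvd_iff)
        then show ?thesis using residue_eqI[of l' q l] l x v_inf infinity by auto
      next
        case (finite y)
        then show ?thesis using eq v_inf x l by auto
      qed
    next
      case v_fin: (finite y)
      from v(2) show ?thesis
      proof (cases rule: proj_line_cases)
        case infinity
        then show ?thesis using eq v_fin x l by auto
      next
        case (finite y')
        have ll: "l = l'" using eq v_fin finite x l by auto
        have "(- (l * y)) mod q = (- (l * y')) mod q" using eq v_fin finite x ll by simp
        then have "q dvd l * (y' - y)" by (simp add: mod_eq_dvd_iff algebra_simps)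
        then have "q dvd y' - y" using l0 q_dvd_mult_iff by blast
        then have "y' = y" using residue_eqI finite v_fin by blast
        then show ?thesis using v_fin finite x ll by simp
      qed
    qed
  qed
  show "cone_point q ` ({1..<q} \<times> proj_line q) = nil_cone q - {(0, 0, 0)}"
  proof (intro subset_antisym subsetI)
    fix z assume "z \<in> cone_point q ` ({1..<q} \<times> proj_line q)"
    then obtain l v where z: "z = cone_point q (l, v)" and l: "l \<in> {1..<q}" and v: "v \<in> proj_line q"
      by blast
    obtain X Y where XY: "v = (X, Y)" by (cases v)
    have l0: "\<not> q dvd l" using l by (auto dest: zdvd_imp_le)
    have "q dvd (- (l * X * Y) mod q)\<^sup>2 + (l * X\<^sup>2 mod q) * (- (l * Y\<^sup>2) mod q)"
    proof -
      have "((- (l * X * Y) mod q)\<^sup>2 + (l * X\<^sup>2 mod q) * (- (l * Y\<^sup>2) mod q)) mod q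
          = ((- (l * X * Y))\<^sup>2 + (l * X\<^sup>2) * (- (l * Y\<^sup>2))) mod q"
        unfolding power2_eq_square by (intro mod_add_cong mod_mult_cong) simp_all
      also have "(- (l * X * Y))\<^sup>2 + (l * X\<^sup>2) * (- (l * Y\<^sup>2)) = 0"
        by Groebner_Basis.algebra
      finally show ?thesis by (simp only: mod_0 mod_eq_0_iff_dvd)
    qed
    moreover have "cone_point q (l, v) \<noteq> (0, 0, 0)"
      using v l0 by (cases rule: proj_line_cases) (auto simp: mod_eq_0_iff_dvd)
    ultimately show "z \<in> nil_cone q - {(0, 0, 0)}"
      using z XY q_ge_2 by (simp add: nil_cone_def)
  next
    fix z assume z: "z \<in> nil_cone q - {(0, 0, 0)}"
    then obtain s b c where sbc: "z = (s, b, c)" "s \<in> {0..<q}" "b \<in> {0..<q}" "c \<in> {0..<q}"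
      and cone: "q dvd s\<^sup>2 + b * c" by (auto simp: nil_cone_def)
    show "z \<in> cone_point q ` ({1..<q} \<times> proj_line q)"
    proof (cases "b = 0")
      case True
      then have "q dvd s" using cone q_dvd_square_iff by simp
      then have "s = 0" using sbc residue_eq_0 by blast
      with True z sbc have "c \<noteq> 0" by auto
      \<comment> \<open>Over \<open>(0, 1)\<close> the third coordinate is \<open>- l\<close>, so
        \<open>l\<close> has to be \<open>- c\<close> moved into the range of residues.\<close>
      with sbc have "q - c \<in> {1..<q}" by auto
      moreover have "z = cone_point q (q - c, 0, 1)"
        using True \<open>s = 0\<close> sbc by simp
      ultimately show ?thesis
        by (intro image_eqI[of _ _ "(q - c, 0, 1)"]) (simp_all add: proj_line_def)
    next
      case False
      then have b: "\<not> q dvd b" using sbc residue_eq_0 by blast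
      obtain y where y: "y \<in> {0..<q}" "q dvd b * y - (- s)"
        using linear_congruence[OF b, of "- s"] by blast
      \<comment> \<open>Multiplying by the unit \<open>b\<close> turns the condition on the third
        coordinate into the cone equation plus a multiple of \<open>b * y + s\<close>.\<close>
      have "b * (c + b * y\<^sup>2) = (s\<^sup>2 + b * c) + (b * y - (- s)) * (b * y - s)"
        by Groebner_Basis.algebra
      then have "q dvd b * (c + b * y\<^sup>2)" using cone y(2) by (metis dvd_add dvd_mult2)
      then have "q dvd c + b * y\<^sup>2" using b q_dvd_mult_iff by blast
      then have "q dvd - (c + b * y\<^sup>2)" by (simp only: dvd_minus_iff)
      also have "- (c + b * y\<^sup>2) = - (b * y\<^sup>2) - c" by simp
      finally have "- (b * y\<^sup>2) mod q = c mod q" by (simp only: mod_eq_dvd_iff)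
      moreover have "- (b * y) mod q = s mod q"
      proof -
        have "q dvd - (b * y - - s)" using y(2) by (simp only: dvd_minus_iff)
        also have "- (b * y - - s) = - (b * y) - s" by simp
        finally show ?thesis by (simp only: mod_eq_dvd_iff)
      qed
      ultimately have "z = cone_point q (b, 1, y)" using sbc by simp
      moreover have "b \<in> {1..<q}" using False sbc by auto
      ultimately show ?thesis using y(1)
        by (intro image_eqI[of _ _ "(b, 1, y)"]) (auto simp: proj_line_def)
    qed
  qed
qed

text \<open>This counts on one generator of the cone without the apex, where a linear form is
  \<open>l * a\<close>. For \<open>a\<close> nonzero the unique solution is \<open>l = 0\<close>
  exactly when \<open>k\<close> vanishes, and that value is excluded.\<close>

lemma card_nonzero_multiples:
  "int (card {l \<in> {1..<q}. q dvd l * a - k}) =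
     (if q dvd a then if q dvd k then q - 1 else 0 else if q dvd k then 0 else 1)"
proof (cases "q dvd a")
  case True
  then have "q dvd l * a - k \<longleftrightarrow> q dvd k" for l
    by (metis dvd_diff_right_iff dvd_mult)
  moreover have "{l::int. 1 \<le> l \<and> l < q} = {1..<q}" by auto
  ultimately show ?thesis using True q_ge_2 by simp
next
  case a: False
  obtain m where m: "m \<in> {0..<q}" "q dvd m * a - k"
    and uniq: "\<And>y. y \<in> {0..<q} \<Longrightarrow> q dvd y * a - k \<Longrightarrow> y = m"
    using linear_congruence[OF a, of k] unfolding mult.commute[of a] by blast
  have "{1..<q} = {0..<q} - {0}" by auto
  then have eq: "{l \<in> {1..<q}. q dvd l * a - k} = {m} - {0}"
    using m uniq by blast
  have "m = 0 \<longleftrightarrow> q dvd k"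
    using m(2) uniq[of 0] q_ge_2 by fastforce
  then show ?thesis unfolding eq using a by auto
qed

text \<open>The signs of the linear form match those in \<open>cone_point\<close>, so that it takes
  the value \<open>l * (A * X^2 + B * X * Y + C * Y^2)\<close>. The apex lies on the plane iff
  \<open>q\<close> divides \<open>k\<close>. In that case each root contributes its whole generator
  and every other point nothing; otherwise each of the \<open>q + 1\<close> points except the roots
  contributes exactly one \<open>l\<close>.\<close>

lemma card_cone_plane:
  "int (card {(s, b, c) \<in> nil_cone q. q dvd A * b - B * s - C * c - k}) =
     (if q dvd k then 1 + (q - 1) * int (card (form_roots q A B C))
      else q + 1 - int (card (form_roots q A B C)))"
proof -
  define F where "F = (\<lambda>(X, Y). A * X\<^sup>2 + B * X * Y + C * Y\<^sup>2)"
  define L where "L = (\<lambda>(s, b, c). q dvd A * b - B * s - C * c - k)"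
  have L_cone: "L (cone_point q (l, v)) \<longleftrightarrow> q dvd l * F v - k" for l v
  proof -
    obtain X Y where v: "v = (X, Y)" by (cases v)
    have "(A * (l * X\<^sup>2 mod q) - B * (- (l * X * Y) mod q) - C * (- (l * Y\<^sup>2) mod q) - k) mod q
        = (A * (l * X\<^sup>2) - B * (- (l * X * Y)) - C * (- (l * Y\<^sup>2)) - k) mod q"
      by (intro mod_diff_cong mod_mult_cong) simp_all
    also have "A * (l * X\<^sup>2) - B * (- (l * X * Y)) - C * (- (l * Y\<^sup>2)) - k = l * F v - k"
      by (simp add: F_def v algebra_simps)
    finally show ?thesis
      unfolding L_def v cone_point.simps split_conv by (simp only: dvd_eq_mod_eq_0)
  qed
  have R: "form_roots q A B C = {v \<in> proj_line q. q dvd F v}"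
    by (auto simp: form_roots_def F_def)
  have zero: "(0, 0, 0) \<in> nil_cone q" using q_ge_2 by (simp add: nil_cone_def)
  have "int (card {z \<in> nil_cone q. L z}) = (\<Sum>z\<in>nil_cone q. of_bool (L z))"
    by (rule int_card_filter[OF finite_nil_cone])
  also have "\<dots> = of_bool (L (0, 0, 0)) + (\<Sum>z\<in>nil_cone q - {(0, 0, 0)}. of_bool (L z))"
    by (rule sum.remove[OF finite_nil_cone zero])
  also have "(\<Sum>z\<in>nil_cone q - {(0, 0, 0)}. of_bool (L z))
      = (\<Sum>x\<in>{1..<q} \<times> proj_line q. of_bool (L (cone_point q x)))"
    by (rule sum.reindex_bij_betw[OF cone_point_bij, symmetric])
  also have "\<dots> = (\<Sum>l\<in>{1..<q}. \<Sum>v\<in>proj_line q. of_bool (q dvd l * F v - k))"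
    by (simp add: sum.cartesian_product L_cone[symmetric] split_def del: cone_point.simps)
  also have "\<dots> = (\<Sum>v\<in>proj_line q. \<Sum>l\<in>{1..<q}. of_bool (q dvd l * F v - k))"
    by (rule sum.swap)
  also have "\<dots> = (\<Sum>v\<in>proj_line q. int (card {l \<in> {1..<q}. q dvd l * F v - k}))"
    by (simp only: int_card_filter finite_atLeastLessThan_int)
  \<comment> \<open>One expression covers all four cases: if \<open>k\<close> is nonzero, the
    contribution \<open>1\<close> of a point is cancelled at a root by the coefficient
    \<open>- 1\<close>.\<close>
  also have "\<dots> = (\<Sum>v\<in>proj_line q. of_bool (\<not> q dvd k) +
      (if q dvd k then q - 1 else - 1) * of_bool (q dvd F v))"
    unfolding card_nonzero_multiples by (intro sum.cong) auto
  also have "\<dots> = (q + 1) * of_bool (\<not> q dvd k) +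
      (if q dvd k then q - 1 else - 1) * int (card (form_roots q A B C))"
    unfolding R int_card_filter[OF finite_proj_line]
    by (simp add: sum.distrib sum_distrib_left card_proj_line)
  finally have "int (card {z \<in> nil_cone q. L z}) = of_bool (L (0, 0, 0)) +
      ((q + 1) * of_bool (\<not> q dvd k) + (if q dvd k then q - 1 else - 1) * int (card (form_roots q A B C)))" .
  moreover have "{z \<in> nil_cone q. L z} = {(s, b, c) \<in> nil_cone q. q dvd A * b - B * s - C * c - k}"
    by (auto simp: L_def)
  ultimately show ?thesis by (auto simp: L_def)
qed

section \<open>Projective roots of special quadratic forms\<close>

lemma form_roots_0: "form_roots q 0 0 0 = proj_line q"
  by (auto simp: form_roots_def)

lemma card_nil_cone: "int (card (nil_cone q)) = q\<^sup>2"
proof -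
  have "int (card (nil_cone q)) = 1 + (q - 1) * int (card (form_roots q 0 0 0))"
    using card_cone_plane[of 0 0 0 0] by (simp add: split_def)
  also have "\<dots> = q\<^sup>2"
    by (simp add: form_roots_0 card_proj_line power2_eq_square algebra_simps)
  finally show ?thesis .
qed

text \<open>The unique point is the normalised representative of the line through the nonzero vector
  \<open>(W, Z)\<close>. This allows images of points under a matrix to be treated as points of
  \<open>proj_line q\<close> again.\<close>

lemma proj_line_orthogonal:
  assumes "\<not> (q dvd W \<and> q dvd Z)"
  shows "\<exists>!v. v \<in> proj_line q \<and> q dvd Z * fst v - W * snd v"
proof (cases "q dvd W")
  case True
  then have Z: "\<not> q dvd Z" using assms by blast
  have "v = (0, 1)" if "v \<in> proj_line q" "q dvd Z * fst v - W * snd v" for v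
    using that(1)
  proof (cases rule: proj_line_cases)
    case infinity
    then show ?thesis .
  next
    case (finite y)
    with that(2) True have "q dvd Z - W * y + W * y" by (intro dvd_add) auto
    then show ?thesis using Z by simp
  qed
  moreover have "(0, 1) \<in> proj_line q \<and> q dvd Z * fst (0, 1) - W * snd (0, 1)"
    using True by (simp add: proj_line_def)
  ultimately show ?thesis by blast
next
  case False
  then obtain y where y: "y \<in> {0..<q}" "q dvd W * y - Z"
    and uniq: "\<And>x. x \<in> {0..<q} \<Longrightarrow> q dvd W * x - Z \<Longrightarrow> x = y"
    using linear_congruence[of W Z] by blast
  have "v = (1, y)" if "v \<in> proj_line q" "q dvd Z * fst v - W * snd v" for v
    using that(1)
  proof (cases rule: proj_line_cases)
    case infinity
    then show ?thesis using that False by simp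
  next
    case (finite x)
    then show ?thesis using that uniq[of x] by (simp add: dvd_diff_commute)
  qed
  moreover have "(1, y) \<in> proj_line q \<and> q dvd Z * fst (1, y) - W * snd (1, y)"
    using y by (simp add: proj_line_def dvd_diff_commute)
  ultimately show ?thesis by blast
qed

lemma proj_line_nonzero: "(X, Y) \<in> proj_line q \<Longrightarrow> \<not> (q dvd X \<and> q dvd Y)"
  using q_not_dvd_1 by (auto simp: proj_line_def)

lemma proj_line_parallel:
  assumes "v \<in> proj_line q" "w \<in> proj_line q" "q dvd snd v * fst w - fst v * snd w"
  shows "w = v"
proof -
  have "\<not> (q dvd fst v \<and> q dvd snd v)" using assms(1) proj_line_nonzero by (cases v) auto
  moreover have "q dvd snd v * fst v - fst v * snd v" by (simp add: mult.commute)
  ultimately show ?thesis using assms proj_line_orthogonal by blast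
qed

text \<open>The form is the product of \<open>Y * X' - X * Y'\<close> and
  \<open>Z * X' - W * Y'\<close>, whose only zeros are \<open>(X, Y)\<close> and the point of
  \<open>(W, Z)\<close>. These coincide iff the determinant \<open>X * Z - Y * W\<close>
  vanishes.\<close>

lemma card_form_roots_split:
  assumes v: "(X, Y) \<in> proj_line q" and w: "\<not> (q dvd W \<and> q dvd Z)"
  shows "card (form_roots q (Y * Z) (- (X * Z + Y * W)) (X * W)) =
    (if q dvd X * Z - Y * W then 1 else 2)"
proof -
  obtain w' where w': "w' \<in> proj_line q" "q dvd Z * fst w' - W * snd w'"
    and w'_uniq: "\<And>x. x \<in> proj_line q \<Longrightarrow> q dvd Z * fst x - W * snd x \<Longrightarrow> x = w'"
    using proj_line_orthogonal[OF w] by blast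
  have v_uniq: "x = (X, Y)" if "x \<in> proj_line q" "q dvd Y * fst x - X * snd x" for x
    using proj_line_parallel[OF v that(1)] that(2) by simp
  have split: "Y * Z * X'\<^sup>2 + - (X * Z + Y * W) * X' * Y' + X * W * Y'\<^sup>2 =
      (Y * X' - X * Y') * (Z * X' - W * Y')" for X' Y'
    by Groebner_Basis.algebra
  have "form_roots q (Y * Z) (- (X * Z + Y * W)) (X * W) = {(X, Y), w'}"
  proof (intro subset_antisym subsetI)
    fix x assume "x \<in> form_roots q (Y * Z) (- (X * Z + Y * W)) (X * W)"
    then have "x \<in> proj_line q" "q dvd (Y * fst x - X * snd x) * (Z * fst x - W * snd x)"
      unfolding form_roots_def split by auto
    then show "x \<in> {(X, Y), w'}" using v_uniq w'_uniq q_dvd_mult_iff by blast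
  next
    fix x assume "x \<in> {(X, Y), w'}"
    then have "x \<in> proj_line q" "q dvd (Y * fst x - X * snd x) * (Z * fst x - W * snd x)"
      using v w' by auto
    then show "x \<in> form_roots q (Y * Z) (- (X * Z + Y * W)) (X * W)"
      unfolding form_roots_def split by (auto simp: split_def)
  qed
  moreover have "(X, Y) = w' \<longleftrightarrow> q dvd X * Z - Y * W"
    using w' w'_uniq[OF v] by (auto simp: mult.commute)
  ultimately show ?thesis by (auto simp: card_insert_if)
qed

lemma form_roots_cong:
  assumes "q dvd A - A'" "q dvd B - B'" "q dvd C - C'"
  shows "form_roots q A B C = form_roots q A' B' C'"
proof -
  have "q dvd (A * X\<^sup>2 + B * X * Y + C * Y\<^sup>2) - (A' * X\<^sup>2 + B' * X * Y + C' * Y\<^sup>2)" for X Y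
  proof -
    have "(A * X\<^sup>2 + B * X * Y + C * Y\<^sup>2) - (A' * X\<^sup>2 + B' * X * Y + C' * Y\<^sup>2)
        = (A - A') * X\<^sup>2 + (B - B') * (X * Y) + (C - C') * Y\<^sup>2"
      by Groebner_Basis.algebra
    then show ?thesis using assms by simp
  qed
  then show ?thesis unfolding form_roots_def using dvd_cong_diff by blast
qed

text \<open>On a non-identity unipotent matrix the fixed point form is the square of a linear form.\<close>

lemma card_form_roots_nilpotent:
  assumes "(s, b, c) \<in> nil_cone q" "(s, b, c) \<noteq> (0, 0, 0)"
  shows "card (form_roots q c (- 2 * s) (- b)) = 1"
proof -
  obtain l v where "(s, b, c) = cone_point q (l, v)" and l: "l \<in> {1..<q}" and v: "v \<in> proj_line q"
    using cone_point_bij assms unfolding bij_betw_def by blast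
  moreover obtain X Y where XY: "v = (X, Y)" by (cases v)
  ultimately have s: "s = - (l * X * Y) mod q" and b: "b = l * X\<^sup>2 mod q" and c: "c = - (l * Y\<^sup>2) mod q"
    by auto
  have l0: "\<not> q dvd l" using l by (auto dest: zdvd_imp_le)
  have "form_roots q c (- 2 * s) (- b) = form_roots q (- (l * Y\<^sup>2)) (2 * l * X * Y) (- (l * X\<^sup>2))"
  proof (rule form_roots_cong)
    have "(- 2 * (- (l * X * Y) mod q)) mod q = (- 2 * (- (l * X * Y))) mod q"
      by (rule mod_mult_right_eq)
    then show "q dvd - 2 * s - 2 * l * X * Y"
      by (simp add: s mod_eq_dvd_iff mult.assoc)
    show "q dvd c - - (l * Y\<^sup>2)"
      unfolding c mod_eq_dvd_iff[symmetric] by simp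
    have "(- (l * X\<^sup>2 mod q)) mod q = (- (l * X\<^sup>2)) mod q"
      by (rule mod_minus_eq)
    then show "q dvd - b - - (l * X\<^sup>2)"
      unfolding b mod_eq_dvd_iff .
  qed
  also have "\<dots> = {(X, Y)}"
  proof -
    have "- (l * Y\<^sup>2) * X'\<^sup>2 + 2 * l * X * Y * X' * Y' + - (l * X\<^sup>2) * Y'\<^sup>2
        = - l * (Y * X' - X * Y')\<^sup>2" for X' Y' by Groebner_Basis.algebra
    then have "q dvd - (l * Y\<^sup>2) * X'\<^sup>2 + 2 * l * X * Y * X' * Y' + - (l * X\<^sup>2) * Y'\<^sup>2
        \<longleftrightarrow> q dvd Y * X' - X * Y'" for X' Y'
      using l0 by (simp add: q_dvd_mult_iff q_dvd_square_iff)
    then have "form_roots q (- (l * Y\<^sup>2)) (2 * l * X * Y) (- (l * X\<^sup>2)) =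
        {x \<in> proj_line q. q dvd Y * fst x - X * snd x}"
      unfolding form_roots_def by auto
    also have "\<dots> = {(X, Y)}"
      using proj_line_parallel v XY by (fastforce simp: mult.commute)
    finally show ?thesis .
  qed
  finally show ?thesis by simp
qed

end

section \<open>Unipotent elements of the special linear group\<close>

text \<open>The form is the determinant of the vector \<open>(X, Y)\<close> and its image
  \<open>(a * X + b * Y, c * X + d * Y)\<close>; it vanishes iff the two are parallel, that is, iff
  the projective point is fixed.\<close>

fun fixed_points :: "nat \<Rightarrow> m2 \<Rightarrow> int" where
  "fixed_points p (a, b, c, d) = int (card (form_roots (int p) c (d - a) (- b)))"

text \<open>With determinant 1, trace 2 means that the characteristic polynomial is
  \<open>(x - 1)^2\<close>. The indicator is integer valued so that it serves as a matrix entry and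
  as a weight in sums.\<close>

definition unip :: "nat \<Rightarrow> m2 \<Rightarrow> int" where
  "unip p g = of_bool (m2_trace g mod int p = 2 mod int p)"

fun unip_of_nil :: "nat \<Rightarrow> int \<times> int \<times> int \<Rightarrow> m2" where
  "unip_of_nil p (s, b, c) = ((1 + s) mod int p, b, c, (1 - s) mod int p)"

abbreviation m2_one :: m2 where
  "m2_one \<equiv> (1, 0, 0, 1)"

locale SL2_prime =
  fixes p :: nat
  assumes prime_p: "prime p"
begin

sublocale prime_residues "int p"
  using prime_p by unfold_locales simp

section \<open>Group structure and translation-invariant sums\<close>

lemma finite_SL2: "finite (SL2 p)"
  by (rule finite_subset[of _ "{0..<int p} \<times> {0..<int p} \<times> {0..<int p} \<times> {0..<int p}"])
    (auto simp: SL2_def)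

lemma SL2_D:
  assumes "(a, b, c, d) \<in> SL2 p"
  shows "a \<in> {0..<int p}" "b \<in> {0..<int p}" "c \<in> {0..<int p}" "d \<in> {0..<int p}"
    "int p dvd a * d - b * c - 1"
  using assms by (simp_all add: SL2_def mod_eq_dvd_iff)

lemma residue_mod: "x mod int p \<in> {0..<int p}"
  using q_ge_2 by simp

lemma m2_mult_closed:
  assumes "x \<in> SL2 p" "y \<in> SL2 p"
  shows "m2_mult p x y \<in> SL2 p"
proof -
  obtain a b c d e f g h where xy: "x = (a, b, c, d)" "y = (e, f, g, h)"
    by (metis prod_cases4)
  have "((a*e + b*g) mod int p * ((c*f + d*h) mod int p)
      - (a*f + b*h) mod int p * ((c*e + d*g) mod int p)) mod int p
      = ((a*e + b*g) * (c*f + d*h) - (a*f + b*h) * (c*e + d*g)) mod int p"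
    by (intro mod_diff_cong mod_mult_cong) simp_all
  also have "(a*e + b*g) * (c*f + d*h) - (a*f + b*h) * (c*e + d*g) = (a*d - b*c) * (e*h - f*g)"
    by Groebner_Basis.algebra
  also have "(a*d - b*c) * (e*h - f*g) mod int p = 1 * 1 mod int p"
    using assms unfolding xy SL2_def by (intro mod_mult_cong) simp_all
  finally show ?thesis
    unfolding xy m2_mult.simps SL2_def using residue_mod by simp
qed

lemma m2_inv_closed:
  assumes "x \<in> SL2 p"
  shows "m2_inv p x \<in> SL2 p"
proof -
  obtain a b c d where x: "x = (a, b, c, d)" by (metis prod_cases4)
  have "(d mod int p * (a mod int p) - - b mod int p * (- c mod int p)) mod int p
      = (d * a - - b * - c) mod int p"
    by (intro mod_diff_cong mod_mult_cong) simp_all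
  also have "d * a - - b * - c = a * d - b * c" by simp
  also have "\<dots> mod int p = 1 mod int p"
    using assms unfolding x SL2_def by simp
  finally show ?thesis
    unfolding x m2_inv.simps SL2_def using residue_mod by simp
qed

lemma m2_mult_assoc: "m2_mult p (m2_mult p x y) z = m2_mult p x (m2_mult p y z)"
proof -
  obtain a b c d e f g h i j k l where
    xyz: "x = (a, b, c, d)" "y = (e, f, g, h)" "z = (i, j, k, l)" by (metis prod_cases4)
  have "((u * v + w * r) mod q * s + (u * v' + w * r') mod q * s') mod q
      = (u * ((v * s + v' * s') mod q) + w * ((r * s + r' * s') mod q)) mod q"
    for u v w r s v' r' s' q :: int
  proof -
    have "((u * v + w * r) mod q * s + (u * v' + w * r') mod q * s') mod q
        = ((u * v + w * r) * s + (u * v' + w * r') * s') mod q"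
      by (intro mod_add_cong mod_mult_cong) simp_all
    also have "(u * v + w * r) * s + (u * v' + w * r') * s' =
        u * (v * s + v' * s') + w * (r * s + r' * s')" by (simp add: algebra_simps)
    also have "\<dots> mod q = (u * ((v * s + v' * s') mod q) + w * ((r * s + r' * s') mod q)) mod q"
      by (intro mod_add_cong mod_mult_cong) simp_all
    finally show ?thesis .
  qed
  then show ?thesis unfolding xyz m2_mult.simps by simp
qed

lemma m2_mult_inv:
  assumes "x \<in> SL2 p"
  shows "m2_mult p (m2_inv p x) x = m2_one" "m2_mult p x (m2_inv p x) = m2_one"
proof -
  obtain a b c d where x: "x = (a, b, c, d)" by (metis prod_cases4)
  have one: "1 mod int p = 1" using q_ge_2 by simp
  have det: "(a * d - b * c) mod int p = 1" using assms one by (simp add: x SL2_def)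
  have red: "(u mod int p * v + w mod int p * r) mod int p = (u * v + w * r) mod int p"
    "(v * (u mod int p) + r * (w mod int p)) mod int p = (v * u + r * w) mod int p" for u v w r
    by (intro mod_add_cong mod_mult_cong; simp)+
  have "(d * a + - b * c) mod int p = 1" "(- c * b + a * d) mod int p = 1"
    "(a * d + b * - c) mod int p = 1" "(c * - b + d * a) mod int p = 1"
    using det by (simp_all add: mult.commute)
  then show "m2_mult p (m2_inv p x) x = m2_one" "m2_mult p x (m2_inv p x) = m2_one"
    unfolding x m2_inv.simps m2_mult.simps red by (simp_all add: mult.commute)
qed

lemma m2_mult_one:
  assumes "x \<in> SL2 p"
  shows "m2_mult p m2_one x = x"
  using assms by (cases x) (auto simp: SL2_def)

lemma m2_inv_cancel:
  assumes "x \<in> SL2 p" "y \<in> SL2 p"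
  shows "m2_mult p (m2_inv p x) (m2_mult p x y) = y" "m2_mult p x (m2_mult p (m2_inv p x) y) = y"
  using assms by (simp_all add: m2_mult_assoc[symmetric] m2_mult_inv m2_mult_one)

lemma m2_mult_bij:
  assumes "x \<in> SL2 p"
  shows "bij_betw (m2_mult p x) (SL2 p) (SL2 p)"
  using assms
  by (intro bij_betw_byWitness[where f' = "m2_mult p (m2_inv p x)"])
    (auto simp: m2_inv_cancel m2_mult_closed m2_inv_closed)

lemma sum_SL2_translate:
  assumes "x \<in> SL2 p"
  shows "(\<Sum>y\<in>SL2 p. f (m2_mult p (m2_inv p x) y)) = (\<Sum>y\<in>SL2 p. f y)"
  by (rule sum.reindex_bij_betw[OF m2_mult_bij[OF m2_inv_closed[OF assms]]])

lemma m2_inv_mult_eq_one_iff: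
  assumes "x \<in> SL2 p" "y \<in> SL2 p"
  shows "m2_mult p (m2_inv p x) y = m2_one \<longleftrightarrow> x = y"
proof
  assume "m2_mult p (m2_inv p x) y = m2_one"
  then have "m2_mult p x m2_one = y" using m2_inv_cancel(2)[OF assms] by simp
  moreover have "m2_mult p x m2_one = x"
    using assms(1) by (cases x) (auto simp: SL2_def)
  ultimately show "x = y" by simp
qed (simp add: m2_mult_inv assms)

text \<open>Substituting \<open>x * h\<close> for \<open>h\<close> shows that the product of two
  kernels depending only on quotients again depends only on the quotient of \<open>x\<close> and
  \<open>y\<close>. Matrix products thus reduce to convolutions on the group.\<close>

lemma sum_SL2_convolution:
  assumes x: "x \<in> SL2 p"
  shows "(\<Sum>h\<in>SL2 p. f (m2_mult p (m2_inv p x) h) * g (m2_mult p (m2_inv p h) y))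
    = (\<Sum>h\<in>SL2 p. f h * g (m2_mult p (m2_inv p h) (m2_mult p (m2_inv p x) y)))"
proof -
  \<comment> \<open>\<open>m2_inv\<close> is the adjugate, which reverses products by a polynomial
    identity.\<close>
  have inv_mult: "m2_inv p (m2_mult p x h) = m2_mult p (m2_inv p h) (m2_inv p x)" for h
  proof -
    obtain a b c d e f g h' where
      xh: "x = (a, b, c, d)" "h = (e, f, g, h')" by (metis prod_cases4)
    have red: "(u mod q * (v mod q) + w mod q * (r mod q)) mod q = (u * v + w * r) mod q"
      for u v w r q :: int
      by (intro mod_add_cong mod_mult_cong; simp)
    show ?thesis unfolding xh m2_inv.simps m2_mult.simps red mod_minus_eq mod_mod_trivial
      by (simp add: algebra_simps)
  qed
  have "(\<Sum>h\<in>SL2 p. f (m2_mult p (m2_inv p x) h) * g (m2_mult p (m2_inv p h) y))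
    = (\<Sum>h\<in>SL2 p. f (m2_mult p (m2_inv p x) (m2_mult p x h)) * g (m2_mult p (m2_inv p (m2_mult p x h)) y))"
    by (rule sum.reindex_bij_betw[OF m2_mult_bij[OF x], symmetric])
  also have "\<dots> = (\<Sum>h\<in>SL2 p. f h * g (m2_mult p (m2_inv p h) (m2_mult p (m2_inv p x) y)))"
    using x by (intro sum.cong) (simp_all add: m2_inv_cancel inv_mult m2_mult_assoc)
  finally show ?thesis .
qed

text \<open>For traceless \<open>K\<close> the determinant of \<open>I + K\<close> is 1 plus that of
  \<open>K\<close>, and its trace is 2. Hence adding the identity matrix carries the cone onto the
  elements of trace 2, with subtraction of the identity as inverse.\<close>

lemma unip_of_nil_bij:
  "bij_betw (unip_of_nil p) (nil_cone (int p)) {h \<in> SL2 p. m2_trace h mod int p = 2 mod int p}"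
proof (rule bij_betw_byWitness[where f' = "\<lambda>(a, b, c, d). ((a - 1) mod int p, b, c)"])
  show "\<forall>z\<in>nil_cone (int p).
      (\<lambda>(a, b, c, d). ((a - 1) mod int p, b, c)) (unip_of_nil p z) = z"
    by (auto simp: nil_cone_def mod_diff_left_eq)
  show "\<forall>h\<in>{h \<in> SL2 p. m2_trace h mod int p = 2 mod int p}.
      unip_of_nil p ((\<lambda>(a, b, c, d). ((a - 1) mod int p, b, c)) h) = h"
  proof
    fix h assume h: "h \<in> {h \<in> SL2 p. m2_trace h mod int p = 2 mod int p}"
    obtain a b c d where abcd: "h = (a, b, c, d)" by (metis prod_cases4)
    have "(1 + (a - 1) mod int p) mod int p = a"
      using h by (simp add: abcd SL2_def mod_add_right_eq)
    moreover have "(1 - (a - 1) mod int p) mod int p = d"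
    proof -
      have "(1 - (a - 1) mod int p) mod int p = (2 - a) mod int p"
        by (simp add: mod_diff_right_eq)
      also have "\<dots> = (a + d - a) mod int p"
        using h unfolding abcd by (intro mod_diff_cong) auto
      finally show ?thesis using h by (simp add: abcd SL2_def)
    qed
    ultimately show "unip_of_nil p ((\<lambda>(a, b, c, d). ((a - 1) mod int p, b, c)) h) = h"
      by (simp add: abcd)
  qed
  show "unip_of_nil p ` nil_cone (int p) \<subseteq> {h \<in> SL2 p. m2_trace h mod int p = 2 mod int p}"
  proof
    fix h assume "h \<in> unip_of_nil p ` nil_cone (int p)"
    then obtain s b c where h: "h = ((1 + s) mod int p, b, c, (1 - s) mod int p)"
      and sbc: "(s, b, c) \<in> nil_cone (int p)" by auto
    have "((1 + s) mod int p * ((1 - s) mod int p) - b * c) mod int p = ((1 + s) * (1 - s) - b * c) mod int p"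
      by (intro mod_diff_cong mod_mult_cong) simp_all
    also have "(1 + s) * (1 - s) - b * c = 1 - (s\<^sup>2 + b * c)"
      by Groebner_Basis.algebra
    also have "\<dots> mod int p = (1 - 0) mod int p"
      using sbc by (intro mod_diff_cong) (auto simp: nil_cone_def)
    finally have "h \<in> SL2 p"
      using sbc residue_mod by (simp add: h SL2_def nil_cone_def)
    moreover have "((1 + s) mod int p + (1 - s) mod int p) mod int p = ((1 + s) + (1 - s)) mod int p"
      by (rule mod_add_eq)
    ultimately show "h \<in> {h \<in> SL2 p. m2_trace h mod int p = 2 mod int p}"
      by (simp add: h)
  qed
  show "(\<lambda>(a, b, c, d). ((a - 1) mod int p, b, c)) `
      {h \<in> SL2 p. m2_trace h mod int p = 2 mod int p} \<subseteq> nil_cone (int p)"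
  proof
    fix z assume "z \<in> (\<lambda>(a, b, c, d). ((a - 1) mod int p, b, c)) `
      {h \<in> SL2 p. m2_trace h mod int p = 2 mod int p}"
    then obtain a b c d where z: "z = ((a - 1) mod int p, b, c)"
      and h: "(a, b, c, d) \<in> SL2 p" and "(a + d) mod int p = 2 mod int p" by auto
    then have tr: "int p dvd a + d - 2" by (simp add: mod_eq_dvd_iff)
    have "(((a - 1) mod int p)\<^sup>2 + b * c) mod int p = ((a - 1)\<^sup>2 + b * c) mod int p"
      by (intro mod_add_cong) (simp_all add: power_mod)
    \<comment> \<open>This writes the cone equation for \<open>h - I\<close> through the defects of
      trace and determinant, both of which vanish modulo \<open>p\<close>.\<close>
    also have "(a - 1)\<^sup>2 + b * c = a * (a + d - 2) - (a * d - b * c - 1)"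
      by Groebner_Basis.algebra
    also have "\<dots> mod int p = 0"
      using tr SL2_D(5)[OF h] by (simp only: mod_eq_0_iff_dvd dvd_diff dvd_mult)
    finally show "z \<in> nil_cone (int p)"
      using SL2_D[OF h] residue_mod by (simp add: z nil_cone_def mod_eq_0_iff_dvd)
  qed
qed

section \<open>Convolutions with the unipotent indicator\<close>

lemma sum_unip:
  "(\<Sum>h\<in>SL2 p. unip p h * f h) = (\<Sum>z\<in>nil_cone (int p). f (unip_of_nil p z))"
proof -
  have "(\<Sum>h\<in>SL2 p. unip p h * f h) = (\<Sum>h | h \<in> SL2 p \<and> m2_trace h mod int p = 2 mod int p. f h)"
    using finite_SL2 by (intro sum.mono_neutral_cong_right) (auto simp: unip_def)
  also have "\<dots> = (\<Sum>z\<in>nil_cone (int p). f (unip_of_nil p z))"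
    by (rule sum.reindex_bij_betw[OF unip_of_nil_bij, symmetric])
  finally show ?thesis .
qed

lemma sum_unip_1: "(\<Sum>h\<in>SL2 p. unip p h) = (int p)\<^sup>2"
  using sum_unip[of "\<lambda>_. 1"] by (simp add: card_nil_cone)

text \<open>The trace of the adjugate of one matrix times another is the polarised determinant, a
  symmetric bilinear form. Removing the inner reductions modulo \<open>p\<close> exhibits the
  condition as linear in each argument.\<close>

lemma unip_inv_mult:
  "unip p (m2_mult p (m2_inv p (a, b, c, d)) (e, f, g, h)) =
    of_bool (int p dvd d * e - b * g - c * f + a * h - 2)"
proof -
  have "((d mod int p * e + - b mod int p * g) mod int p
      + (- c mod int p * f + a mod int p * h) mod int p) mod int p
      = ((d * e + - b * g) + (- c * f + a * h)) mod int p"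
    unfolding mod_add_eq by (intro mod_add_cong mod_mult_cong) simp_all
  also have "(d * e + - b * g) + (- c * f + a * h) = d * e - b * g - c * f + a * h" by simp
  finally have "m2_trace (m2_mult p (m2_inv p (a, b, c, d)) (e, f, g, h)) mod int p
      = (d * e - b * g - c * f + a * h) mod int p"
    by (simp only: m2_inv.simps m2_mult.simps m2_trace.simps)
  then show ?thesis unfolding unip_def by (simp only: mod_eq_dvd_iff[of _ _ 2])
qed

text \<open>A point \<open>v\<close> is fixed by the quotient of \<open>x\<close> and
  \<open>y\<close> iff \<open>x v\<close> and \<open>y v\<close> are parallel, and the form on the
  right is the determinant of these two vectors.\<close>

lemma fixed_points_inv_mult:
  "fixed_points p (m2_mult p (m2_inv p (a, b, c, d)) (e, f, g, h)) =
    int (card (form_roots (int p) (a * g - c * e) (a * h + b * g - c * f - d * e) (b * h - d * f)))"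
proof -
  let ?A = "(- c mod int p * e + a mod int p * g) mod int p"
  let ?B = "(- c mod int p * f + a mod int p * h) mod int p - (d mod int p * e + - b mod int p * g) mod int p"
  let ?C = "- ((d mod int p * f + - b mod int p * h) mod int p)"
  have "?A mod int p = (- c * e + a * g) mod int p"
    unfolding mod_mod_trivial by (intro mod_add_cong mod_mult_cong) simp_all
  moreover have "- c * e + a * g = a * g - c * e" by simp
  ultimately have A: "int p dvd ?A - (a * g - c * e)" by (simp only: mod_eq_dvd_iff)
  have "?B mod int p = ((- c * f + a * h) - (d * e + - b * g)) mod int p"
    unfolding mod_diff_eq by (intro mod_add_cong mod_diff_cong mod_mult_cong) simp_all
  moreover have "(- c * f + a * h) - (d * e + - b * g) = a * h + b * g - c * f - d * e" by simp
  ultimately have B: "int p dvd ?B - (a * h + b * g - c * f - d * e)"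
    by (simp only: mod_eq_dvd_iff)
  have "?C mod int p = (- (d * f + - b * h)) mod int p"
    unfolding mod_minus_eq by (intro mod_minus_cong mod_add_cong mod_mult_cong) simp_all
  moreover have "- (d * f + - b * h) = b * h - d * f" by simp
  ultimately have C: "int p dvd ?C - (b * h - d * f)"
    by (simp only: mod_eq_dvd_iff)
  show ?thesis
    unfolding m2_inv.simps m2_mult.simps fixed_points.simps
    using form_roots_cong[OF A B C] by simp
qed

text \<open>Double counting of the pairs of a unipotent \<open>h\<close> and a point
  \<open>v\<close> for which \<open>h v\<close> and \<open>x v\<close> are parallel. For fixed
  \<open>v\<close> the condition is affine linear in \<open>h - I\<close>, hence a plane section of
  the cone; it has \<open>p\<close> points if \<open>x\<close> fixes \<open>v\<close> and
  \<open>p - 1\<close> otherwise. Summation over the \<open>p + 1\<close> points gives the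
  formula.\<close>

lemma unip_convolution_fixed_points:
  assumes "x \<in> SL2 p"
  shows "(\<Sum>h\<in>SL2 p. unip p h * fixed_points p (m2_mult p (m2_inv p h) x))
    = fixed_points p x + (int p)\<^sup>2 - 1"
proof -
  obtain e f g h where x: "x = (e, f, g, h)" by (metis prod_cases4)
  define F where "F = (\<lambda>(X, Y). X * (g * X + h * Y) - Y * (e * X + f * Y))"
  define L where "L = (\<lambda>(s, b, c) (X, Y).
    ((1 + s) * X + b * Y) * (g * X + h * Y) - (c * X + (1 - s) * Y) * (e * X + f * Y))"
  have roots: "form_roots (int p) ((1 + s) * g - c * e)
      ((1 + s) * h + b * g - c * f - (1 - s) * e) (b * h - (1 - s) * f)
      = {v \<in> proj_line (int p). int p dvd L (s, b, c) v}" for s b c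
  proof -
    have "((1 + s) * g - c * e) * X\<^sup>2 + ((1 + s) * h + b * g - c * f - (1 - s) * e) * X * Y
        + (b * h - (1 - s) * f) * Y\<^sup>2 = L (s, b, c) (X, Y)" for X Y
      unfolding L_def by (simp add: algebra_simps power2_eq_square)
    then show ?thesis by (auto simp: form_roots_def)
  qed
  have count: "int (card {z \<in> nil_cone (int p). int p dvd L z v}) =
      int p - 1 + of_bool (int p dvd F v)" if v: "v \<in> proj_line (int p)" for v
  proof -
    obtain X Y where XY: "v = (X, Y)" by (cases v)
    \<comment> \<open>\<open>(W, Z)\<close> is the image of \<open>v\<close> under \<open>x\<close>;
      it is nonzero because \<open>x\<close> is invertible, which the adjugate identities below make
      explicit.\<close>
    define W Z where "W = e * X + f * Y" and "Z = g * X + h * Y"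
    have F: "F v = X * Z - Y * W" by (simp add: F_def XY W_def Z_def)
    have det: "int p dvd e * h - f * g - 1" using assms SL2_D(5) x by blast
    have nonzero: "\<not> (int p dvd W \<and> int p dvd Z)"
    proof
      assume WZ: "int p dvd W \<and> int p dvd Z"
      have "X = h * W - f * Z - X * (e * h - f * g - 1)"
        unfolding W_def Z_def by (simp add: algebra_simps)
      then have "int p dvd X" using WZ det by (metis dvd_diff dvd_mult)
      moreover have "Y = e * Z - g * W - Y * (e * h - f * g - 1)"
        unfolding W_def Z_def by (simp add: algebra_simps)
      then have "int p dvd Y" using WZ det by (metis dvd_diff dvd_mult)
      ultimately show False using proj_line_nonzero v XY by blast
    qed
    have "L (s, b, c) v = (Y * Z) * b - (- (X * Z + Y * W)) * s - (X * W) * c - (- F v)" for s b c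
      unfolding F by (simp add: L_def XY W_def Z_def algebra_simps)
    then have eq: "{z \<in> nil_cone (int p). int p dvd L z v} = {(s, b, c) \<in> nil_cone (int p).
        int p dvd (Y * Z) * b - (- (X * Z + Y * W)) * s - (X * W) * c - (- F v)}"
      by auto
    \<comment> \<open>If \<open>x\<close> fixes \<open>v\<close>, the plane contains the apex and
      the split form has one root, giving \<open>1 + (p - 1)\<close>; otherwise there are two roots,
      giving \<open>p + 1 - 2\<close>.\<close>
    show ?thesis
      unfolding eq card_cone_plane card_form_roots_split[OF v[unfolded XY] nonzero] dvd_minus_iff F
      by simp
  qed
  have "(\<Sum>h\<in>SL2 p. unip p h * fixed_points p (m2_mult p (m2_inv p h) x))
      = (\<Sum>z\<in>nil_cone (int p). \<Sum>v\<in>proj_line (int p). of_bool (int p dvd L z v))"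
  proof -
    have "fixed_points p (m2_mult p (m2_inv p (unip_of_nil p (s, b, c))) x)
      = (\<Sum>v\<in>proj_line (int p). of_bool (int p dvd L (s, b, c) v))" for s b c
    proof -
      have "form_roots (int p) ((1 + s) mod int p * g - c * e)
          ((1 + s) mod int p * h + b * g - c * f - (1 - s) mod int p * e) (b * h - (1 - s) mod int p * f)
        = form_roots (int p) ((1 + s) * g - c * e)
          ((1 + s) * h + b * g - c * f - (1 - s) * e) (b * h - (1 - s) * f)"
        by (rule form_roots_cong; unfold mod_eq_dvd_iff[symmetric],
            intro mod_add_cong mod_diff_cong mod_mult_cong) simp_all
      then show ?thesis
        unfolding x unip_of_nil.simps fixed_points_inv_mult roots
        by (simp only: int_card_filter[OF finite_proj_line])
    qed
    then show ?thesis unfolding sum_unip by (intro sum.cong) auto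
  qed
  also have "\<dots> = (\<Sum>v\<in>proj_line (int p). int (card {z \<in> nil_cone (int p). int p dvd L z v}))"
    unfolding int_card_filter[OF finite_nil_cone] by (rule sum.swap)
  also have "\<dots> = (\<Sum>v\<in>proj_line (int p). int p - 1 + of_bool (int p dvd F v))"
    by (intro sum.cong refl count)
  also have "\<dots> = (int p + 1) * (int p - 1) + int (card {v \<in> proj_line (int p). int p dvd F v})"
    unfolding int_card_filter[OF finite_proj_line] by (simp add: sum.distrib card_proj_line)
  also have "{v \<in> proj_line (int p). int p dvd F v} = form_roots (int p) g (h - e) (- f)"
  proof -
    have "g * X\<^sup>2 + (h - e) * X * Y + - f * Y\<^sup>2 = F (X, Y)" for X Y
      unfolding F_def by (simp add: algebra_simps power2_eq_square)
    then show ?thesis by (auto simp: form_roots_def)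
  qed
  finally show ?thesis unfolding x fixed_points.simps by (simp add: power2_eq_square algebra_simps)
qed

lemma fixed_points_one: "fixed_points p m2_one = int p + 1"
  by (simp add: form_roots_0 card_proj_line)

text \<open>For \<open>x = I + K\<close> the fixed point form depends only on \<open>K\<close>: for
  nonzero \<open>K\<close> it has the kernel of \<open>K\<close> as its single root, and for
  \<open>K = 0\<close> it vanishes at all \<open>p + 1\<close> points.\<close>

lemma fixed_points_unip:
  assumes "x \<in> SL2 p" "unip p x = 1"
  shows "fixed_points p x = 1 + int p * of_bool (x = m2_one)"
proof -
  obtain s b c where sbc: "(s, b, c) \<in> nil_cone (int p)" and x: "x = unip_of_nil p (s, b, c)"
  proof -
    have "x \<in> unip_of_nil p ` nil_cone (int p)"
      using unip_of_nil_bij assms unfolding bij_betw_def unip_def by simp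
    then show ?thesis using that by auto
  qed
  have "int p dvd ((1 - s) mod int p - (1 + s) mod int p) - (- 2 * s)"
  proof -
    have "((1 - s) mod int p - (1 + s) mod int p) mod int p = ((1 - s) - (1 + s)) mod int p"
      by (rule mod_diff_eq)
    then show ?thesis by (simp add: mod_eq_dvd_iff)
  qed
  then have fp: "fixed_points p x = int (card (form_roots (int p) c (- 2 * s) (- b)))"
    unfolding x unip_of_nil.simps fixed_points.simps
    by (subst form_roots_cong[of _ c _ "- 2 * s" _ "- b"]) simp_all
  show ?thesis
  proof (cases "(s, b, c) = (0, 0, 0)")
    case True
    then have "x = m2_one" using x q_ge_2 by simp
    then show ?thesis using fixed_points_one by simp
  next
    case False
    have zero: "(0, 0, 0) \<in> nil_cone (int p)" using q_ge_2 by (simp add: nil_cone_def)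
    have one: "unip_of_nil p (0, 0, 0) = m2_one" using q_ge_2 by simp
    have "x \<noteq> m2_one"
      using inj_onD[OF bij_betw_imp_inj_on[OF unip_of_nil_bij] _ sbc zero] False
      unfolding x one by blast
    then show ?thesis using fp card_form_roots_nilpotent[OF sbc False] by simp
  qed
qed

text \<open>The inverse of \<open>I + K\<close> is \<open>I - K\<close>, so the trace condition on
  the quotient is affine linear in \<open>K\<close>. The quadratic form attached to this plane is
  exactly the fixed point form of \<open>x\<close>, and its constant term is the trace of
  \<open>x\<close> minus 2.\<close>

lemma unip_convolution_unip:
  assumes "x \<in> SL2 p"
  shows "(\<Sum>h\<in>SL2 p. unip p h * unip p (m2_mult p (m2_inv p h) x))
    = (int p)\<^sup>2 * of_bool (x = m2_one) + int p + 1 - fixed_points p x"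
proof -
  obtain e f g h where x: "x = (e, f, g, h)" by (metis prod_cases4)
  have "unip p (m2_mult p (m2_inv p (unip_of_nil p (s, b, c))) x) =
      of_bool (int p dvd g * b - (h - e) * s - - f * c - (e + h - 2))" for s b c
  proof -
    have "((1 - s) mod int p * e - b * g - c * f + (1 + s) mod int p * h - 2) mod int p
        = ((1 - s) * e - b * g - c * f + (1 + s) * h - 2) mod int p"
      by (intro mod_add_cong mod_diff_cong mod_mult_cong) simp_all
    moreover have "(1 - s) * e - b * g - c * f + (1 + s) * h - 2 =
        - (g * b - (h - e) * s - - f * c - (e + h - 2))" by (simp add: algebra_simps)
    ultimately have "int p dvd (1 - s) mod int p * e - b * g - c * f + (1 + s) mod int p * h - 2
        \<longleftrightarrow> int p dvd g * b - (h - e) * s - - f * c - (e + h - 2)"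
      by (metis dvd_minus_iff mod_eq_0_iff_dvd)
    then show ?thesis unfolding x unip_of_nil.simps unip_inv_mult by simp
  qed
  then have "(\<Sum>h\<in>SL2 p. unip p h * unip p (m2_mult p (m2_inv p h) x)) =
      (\<Sum>z\<in>nil_cone (int p). of_bool ((\<lambda>(s, b, c).
        int p dvd g * b - (h - e) * s - - f * c - (e + h - 2)) z))"
    unfolding sum_unip by (intro sum.cong) auto
  also have "\<dots> = int (card {z \<in> nil_cone (int p). (\<lambda>(s, b, c).
        int p dvd g * b - (h - e) * s - - f * c - (e + h - 2)) z})"
    by (rule int_card_filter[OF finite_nil_cone, symmetric])
  also have "{z \<in> nil_cone (int p). (\<lambda>(s, b, c).
        int p dvd g * b - (h - e) * s - - f * c - (e + h - 2)) z} =
      {(s, b, c) \<in> nil_cone (int p). int p dvd g * b - (h - e) * s - - f * c - (e + h - 2)}"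
    by auto
  also have "int (card \<dots>) = (if int p dvd e + h - 2 then 1 + (int p - 1) * fixed_points p x
      else int p + 1 - fixed_points p x)"
    unfolding card_cone_plane x fixed_points.simps by simp
  \<comment> \<open>For trace 2 the number of fixed points is \<open>1\<close> or
    \<open>p + 1\<close>. The value \<open>1\<close> makes both cases of the count agree, and
    \<open>p + 1\<close>, attained at the identity, produces the extra \<open>p^2\<close>.\<close>
  also have "\<dots> = (int p)\<^sup>2 * of_bool (x = m2_one) + int p + 1 - fixed_points p x"
  proof (cases "int p dvd e + h - 2")
    case True
    then have "unip p x = 1" by (simp add: x unip_def mod_eq_dvd_iff)
    then show ?thesis
      using True fixed_points_unip[OF assms] by (simp add: algebra_simps power2_eq_square)
  next
    case False
    then have "x \<noteq> m2_one" using x by auto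
    then show ?thesis using False by simp
  qed
  finally show ?thesis .
qed

text \<open>On average an element fixes one point, as Burnside's lemma predicts for a transitive
  action. Here it follows by summing the convolution identity over the group: both sides are affine
  in the unknown sum, with coefficients \<open>p^2\<close> and \<open>1\<close>.\<close>

lemma sum_fixed_points: "(\<Sum>x\<in>SL2 p. fixed_points p x) = int (card (SL2 p))"
proof -
  let ?S = "\<Sum>x\<in>SL2 p. fixed_points p x"
  have "(int p)\<^sup>2 * ?S = (\<Sum>h\<in>SL2 p. unip p h * ?S)"
    by (simp add: sum_distrib_right[symmetric] sum_unip_1)
  also have "\<dots> = (\<Sum>h\<in>SL2 p. \<Sum>x\<in>SL2 p. unip p h * fixed_points p (m2_mult p (m2_inv p h) x))"
    by (intro sum.cong refl) (simp only: sum_distrib_left[symmetric] sum_SL2_translate)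
  also have "\<dots> = (\<Sum>x\<in>SL2 p. fixed_points p x + (int p)\<^sup>2 - 1)"
    by (subst sum.swap) (intro sum.cong refl unip_convolution_fixed_points)
  also have "\<dots> = ?S + ((int p)\<^sup>2 - 1) * int (card (SL2 p))"
    by (simp add: sum.distrib sum_subtractf algebra_simps)
  finally have "((int p)\<^sup>2 - 1) * ?S = ((int p)\<^sup>2 - 1) * int (card (SL2 p))"
    by (simp add: algebra_simps)
  moreover have "1 < (int p)\<^sup>2"
    using q_ge_2 by (intro one_less_power) simp_all
  ultimately show ?thesis by simp
qed

text \<open>Summing \<open>unip_convolution_unip\<close> over the group gives
  \<open>p^4 = p^2 + (p + 1) * |G| - |G|\<close>, which is solved for the order.\<close>

lemma card_SL2: "int (card (SL2 p)) = int p ^ 3 - int p"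
proof -
  have one: "m2_one \<in> SL2 p" using q_ge_2 by (simp add: SL2_def)
  have "(int p)\<^sup>2 * (int p)\<^sup>2 = (\<Sum>h\<in>SL2 p. unip p h * (\<Sum>x\<in>SL2 p. unip p x))"
    by (simp add: sum_distrib_right[symmetric] sum_unip_1)
  also have "\<dots> = (\<Sum>h\<in>SL2 p. \<Sum>x\<in>SL2 p. unip p h * unip p (m2_mult p (m2_inv p h) x))"
    by (intro sum.cong refl) (simp only: sum_distrib_left[symmetric] sum_SL2_translate)
  also have "\<dots> = (\<Sum>x\<in>SL2 p. (int p)\<^sup>2 * of_bool (x = m2_one) + int p + 1 - fixed_points p x)"
    by (subst sum.swap) (intro sum.cong refl unip_convolution_unip)
  also have "\<dots> = (int p)\<^sup>2 + int p * int (card (SL2 p))"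
    using finite_SL2 one
    by (simp add: sum.distrib sum_subtractf sum_fixed_points sum_distrib_left[symmetric]
        of_bool_def sum.delta algebra_simps del: sum_mult_of_bool_eq sum_of_bool_mult_eq)
  finally have "int p * int (card (SL2 p)) = int p * (int p ^ 3 - int p)"
    by (simp add: algebra_simps power2_eq_square power3_eq_cube)
  then show ?thesis using q_ge_2 by simp
qed

end

section \<open>Spectra and power sums\<close>

lemma trace_mat_mult_comm:
  fixes X Y :: "'a :: comm_semiring_0 mat"
  assumes "X \<in> carrier_mat n n" "Y \<in> carrier_mat n n"
  shows "(\<Sum>i<n. (X * Y) $$ (i, i)) = (\<Sum>i<n. (Y * X) $$ (i, i))"
proof -
  have "(\<Sum>i<n. (X * Y) $$ (i, i)) = (\<Sum>i<n. \<Sum>k<n. X $$ (i, k) * Y $$ (k, i))"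
    using assms by (intro sum.cong) (auto simp: scalar_prod_def lessThan_atLeast0)
  also have "\<dots> = (\<Sum>k<n. \<Sum>i<n. Y $$ (k, i) * X $$ (i, k))"
    by (subst sum.swap) (simp add: mult.commute)
  also have "\<dots> = (\<Sum>i<n. (Y * X) $$ (i, i))"
    using assms by (intro sum.cong) (auto simp: scalar_prod_def lessThan_atLeast0)
  finally show ?thesis .
qed

lemma upper_triangular_pow_diag:
  fixes B :: "'a :: comm_semiring_1 mat"
  assumes B: "B \<in> carrier_mat n n" and ut: "upper_triangular B"
  shows "(\<forall>i<n. \<forall>j<i. (B ^\<^sub>m k) $$ (i, j) = 0) \<and> (\<forall>i<n. (B ^\<^sub>m k) $$ (i, i) = (B $$ (i, i)) ^ k)"
proof (induction k)
  case 0
  then show ?case using B by auto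
next
  case (Suc k)
  have C: "B ^\<^sub>m k \<in> carrier_mat n n" using B by simp
  have prod: "(B ^\<^sub>m Suc k) $$ (i, j) = (\<Sum>l<n. (B ^\<^sub>m k) $$ (i, l) * B $$ (l, j))"
    if "i < n" "j < n" for i j
    using B C that by (simp add: scalar_prod_def lessThan_atLeast0)
  have zero: "B $$ (l, j) = 0" if "j < l" "l < n" for l j
    using upper_triangularD[OF ut that(1)] B that by simp
  \<comment> \<open>For \<open>l < i\<close> the first factor lies below the diagonal; otherwise
    \<open>l > j\<close> and the second factor does.\<close>
  have vanish: "(B ^\<^sub>m k) $$ (i, l) * B $$ (l, j) = 0" if "i < n" "l < n" "j < i \<or> j = i \<and> l \<noteq> i" for i j l
    using Suc zero that by (metis linorder_neqE_nat mult_not_zero order_less_trans)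
  have "(\<Sum>l<n. (B ^\<^sub>m k) $$ (i, l) * B $$ (l, j)) = 0" if "i < n" "j < i" for i j
    using that vanish by (intro sum.neutral) auto
  moreover have "(\<Sum>l<n. (B ^\<^sub>m k) $$ (i, l) * B $$ (l, i)) = (B ^\<^sub>m k) $$ (i, i) * B $$ (i, i)" if "i < n" for i
    using that vanish
    by (subst sum.remove[of _ i]) (auto intro!: sum.neutral)
  ultimately show ?case using prod Suc by (simp add: mult.commute)
qed

text \<open>Schur decomposition makes the matrix similar to a triangular one with diagonal
  \<open>es\<close>. Traces of powers are invariant under similarity, and powers of a triangular
  matrix have the powers of its entries on the diagonal.\<close>

lemma char_poly_power_sums:
  fixes A :: "complex mat"
  assumes A: "A \<in> carrier_mat n n"
  shows "\<exists>es. char_poly A = (\<Prod>e\<leftarrow>es. [:- e, 1:]) \<and>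
    (\<forall>k. (\<Sum>i<n. (A ^\<^sub>m k) $$ (i, i)) = (\<Sum>e\<leftarrow>es. e ^ k))"
proof -
  obtain es where es: "char_poly A = (\<Prod>e\<leftarrow>es. [:- e, 1:])" "length es = n"
    using char_poly_factorized[OF A] by blast
  obtain B P Q where schur: "schur_decomposition A es = (B, P, Q)" by (metis prod_cases3)
  have sim: "similar_mat_wit A B P Q" and ut: "upper_triangular B" and diag: "diag_mat B = es"
    using schur_decomposition[OF A es(1) schur] by auto
  note wit = similar_mat_witD2[OF A sim]
  have "(\<Sum>i<n. (A ^\<^sub>m k) $$ (i, i)) = (\<Sum>e\<leftarrow>es. e ^ k)" for k
  proof -
    have C: "B ^\<^sub>m k \<in> carrier_mat n n" using wit by simp
    have "(\<Sum>i<n. (A ^\<^sub>m k) $$ (i, i)) = (\<Sum>i<n. (P * (B ^\<^sub>m k) * Q) $$ (i, i))"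
      using similar_mat_wit_pow_id[OF sim] by simp
    also have "\<dots> = (\<Sum>i<n. (Q * (P * (B ^\<^sub>m k))) $$ (i, i))"
      using wit C by (intro trace_mat_mult_comm) auto
    also have "Q * (P * (B ^\<^sub>m k)) = B ^\<^sub>m k"
      using assoc_mult_mat[OF wit(7,6) C] wit(2) left_mult_one_mat[OF C] by simp
    also have "(\<Sum>i<n. (B ^\<^sub>m k) $$ (i, i)) = (\<Sum>i<n. (B $$ (i, i)) ^ k)"
      using upper_triangular_pow_diag[OF wit(5) ut] by simp
    also have "\<dots> = (\<Sum>e\<leftarrow>es. e ^ k)"
      using wit unfolding diag[symmetric] diag_mat_def
      by (simp add: sum_list_distinct_conv_sum_set lessThan_atLeast0 comp_def)
    finally show ?thesis .
  qed
  then show ?thesis using es(1) by blast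
qed

section \<open>Possible eigenvalues and their multiplicities\<close>

lemma sum_list_count_list:
  fixes f :: "'a \<Rightarrow> 'b :: comm_semiring_1"
  assumes "set xs \<subseteq> S" "finite S"
  shows "(\<Sum>x\<leftarrow>xs. f x) = (\<Sum>x\<in>S. of_nat (count_list xs x) * f x)"
  using assms(1)
proof (induction xs)
  case (Cons y xs)
  have "(\<Sum>x\<in>S. of_nat (count_list (y # xs) x) * f x)
      = (\<Sum>x\<in>S. (if x = y then f x else 0) + of_nat (count_list xs x) * f x)"
    by (intro sum.cong) (auto simp: algebra_simps)
  also have "\<dots> = f y + (\<Sum>x\<leftarrow>xs. f x)"
    using Cons assms(2) by (simp add: sum.distrib sum.delta)
  finally show ?case by simp
qed simp

lemma prod_list_count_list:
  fixes f :: "'a \<Rightarrow> 'b :: comm_monoid_mult"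
  assumes "set xs \<subseteq> S" "finite S"
  shows "(\<Prod>x\<leftarrow>xs. f x) = (\<Prod>x\<in>S. f x ^ count_list xs x)"
  using assms(1)
proof (induction xs)
  case (Cons y xs)
  have "(\<Prod>x\<in>S. f x ^ count_list (y # xs) x)
      = (\<Prod>x\<in>S. (if x = y then f x else 1) * f x ^ count_list xs x)"
    by (intro prod.cong) auto
  also have "\<dots> = f y * (\<Prod>x\<leftarrow>xs. f x)"
    using Cons assms(2) by (simp add: prod.distrib prod.delta)
  finally show ?case by simp
qed simp

text \<open>The hypotheses say that \<open>A^2 = r^2 I + s J - P\<close>,
  \<open>A P = t J - P\<close> and \<open>A J = m J\<close>, with \<open>J\<close> the all-ones
  matrix. Eliminating \<open>P\<close> on an eigenvector \<open>v\<close> shows that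
  \<open>(r^2 - e^2) * (e + 1) * v\<close> is a constant vector. A nonzero constant vector has
  eigenvalue \<open>m\<close>, so either \<open>e = m\<close> or the scalar factor is 0.\<close>

lemma eigenvalue_of_quadratic_relations:
  fixes A P :: "nat \<Rightarrow> nat \<Rightarrow> complex"
  assumes square: "\<And>i j. i < n \<Longrightarrow> j < n \<Longrightarrow> (\<Sum>k<n. A i k * A k j) = r\<^sup>2 * of_bool (i = j) + s - P i j"
    and mult_P: "\<And>i j. i < n \<Longrightarrow> j < n \<Longrightarrow> (\<Sum>k<n. A i k * P k j) = t - P i j"
    and row_sum: "\<And>i. i < n \<Longrightarrow> (\<Sum>k<n. A i k) = m"
    and eigen: "\<And>i. i < n \<Longrightarrow> (\<Sum>k<n. A i k * v k) = e * v i"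
    and nonzero: "i0 < n" "v i0 \<noteq> 0"
  shows "e \<in> {m, r, - 1, - r}"
proof -
  define V where "V = (\<Sum>j<n. v j)"
  define w where "w i = (\<Sum>j<n. P i j * v j)" for i
  have assoc: "(\<Sum>k<n. A i k * (\<Sum>j<n. X k j * v j)) = (\<Sum>j<n. (\<Sum>k<n. A i k * X k j) * v j)" for X i
    unfolding sum_distrib_left sum_distrib_right by (subst sum.swap) (simp add: mult.assoc)
  have w: "w i = (r\<^sup>2 - e\<^sup>2) * v i + s * V" if i: "i < n" for i
  proof -
    have "e * (e * v i) = (\<Sum>k<n. A i k * (e * v k))"
      unfolding eigen[OF i, symmetric] sum_distrib_left by (simp add: mult.left_commute)
    also have "\<dots> = (\<Sum>k<n. A i k * (\<Sum>j<n. A k j * v j))"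
      using eigen by (intro sum.cong) auto
    also have "\<dots> = (\<Sum>j<n. (r\<^sup>2 * of_bool (i = j) + s - P i j) * v j)"
      unfolding assoc using square i by (intro sum.cong) auto
    also have "\<dots> = (\<Sum>j<n. r\<^sup>2 * (if i = j then v j else 0) + s * v j - P i j * v j)"
      by (intro sum.cong) (auto simp: algebra_simps)
    also have "\<dots> = r\<^sup>2 * v i + s * V - w i"
      using i by (simp add: sum.distrib sum_subtractf sum_distrib_left[symmetric] V_def w_def)
    finally show ?thesis by (simp add: algebra_simps power2_eq_square)
  qed
  have Aw: "(r\<^sup>2 - e\<^sup>2) * (e * v i) + s * V * m = t * V - w i" if i: "i < n" for i
  proof -
    have "(r\<^sup>2 - e\<^sup>2) * (e * v i) + s * V * m =
        (\<Sum>k<n. (r\<^sup>2 - e\<^sup>2) * (A i k * v k) + s * V * A i k)"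
      by (simp only: sum.distrib sum_distrib_left[symmetric] eigen[OF i] row_sum[OF i])
    also have "\<dots> = (\<Sum>k<n. A i k * w k)"
      by (intro sum.cong) (simp_all add: w algebra_simps)
    also have "\<dots> = (\<Sum>j<n. (t - P i j) * v j)"
      unfolding w_def assoc using mult_P i by (intro sum.cong) auto
    also have "\<dots> = t * V - w i"
      by (simp add: sum_subtractf sum_distrib_left left_diff_distrib V_def w_def)
    finally show ?thesis .
  qed
  define c where "c = (t - s - s * m) * V"
  have const: "(r\<^sup>2 - e\<^sup>2) * (e + 1) * v i = c" if "i < n" for i
    using Aw[OF that] w[OF that] unfolding c_def by (simp add: algebra_simps)
  \<comment> \<open>Row \<open>i0\<close> of the matrix is applied to the constant vector in two
    ways: by its row sum, and by the eigenvalue equation for \<open>v\<close>.\<close>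
  have "m * c = (\<Sum>k<n. A i0 k * c)"
    by (simp only: sum_distrib_right[symmetric] row_sum[OF nonzero(1)])
  also have "\<dots> = (\<Sum>k<n. (r\<^sup>2 - e\<^sup>2) * (e + 1) * (A i0 k * v k))"
    by (intro sum.cong refl) (simp add: const[symmetric] mult_ac)
  also have "\<dots> = e * c"
    unfolding sum_distrib_left[symmetric] eigen[OF nonzero(1)] const[OF nonzero(1), symmetric]
    by (simp only: mult_ac)
  finally have "(e - m) * c = 0" by (auto simp: left_diff_distrib)
  then have "(e - m) * ((r\<^sup>2 - e\<^sup>2) * (e + 1) * v i0) = 0"
    unfolding const[OF nonzero(1)] .
  then have "e = m \<or> r\<^sup>2 = e\<^sup>2 \<or> e = - 1"
    using nonzero(2) by (auto simp: eq_neg_iff_add_eq_0)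
  then show ?thesis by (auto simp: power2_eq_iff)
qed

text \<open>Over the complex numbers every root of the characteristic polynomial is an eigenvalue,
  hence an integer from \<open>S\<close>; the factorisation descends because the embedding of
  integer polynomials is injective. Taking \<open>S\<close> as a set merges coinciding candidates,
  as happens for \<open>p = 2\<close>.\<close>

lemma int_char_poly_power_sums:
  fixes A :: "int mat" and S :: "int set"
  assumes A: "A \<in> carrier_mat n n" and fin: "finite S"
    and spectrum: "\<And>e v i0. i0 < n \<Longrightarrow> v i0 \<noteq> 0 \<Longrightarrow>
      (\<And>i. i < n \<Longrightarrow> (\<Sum>k<n. complex_of_int (A $$ (i, k)) * v k) = e * v i) \<Longrightarrow> e \<in> of_int ` S"
  shows "\<exists>c. char_poly A = (\<Prod>y\<in>S. [:- y, 1:] ^ c y) \<and>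
    (\<forall>k. (\<Sum>i<n. (A ^\<^sub>m k) $$ (i, i)) = (\<Sum>y\<in>S. int (c y) * y ^ k))"
proof -
  let ?B = "map_mat complex_of_int A"
  have B: "?B \<in> carrier_mat n n" using A by simp
  obtain es where es: "char_poly ?B = (\<Prod>e\<leftarrow>es. [:- e, 1:])"
    "\<And>k. (\<Sum>i<n. (?B ^\<^sub>m k) $$ (i, i)) = (\<Sum>e\<leftarrow>es. e ^ k)"
    using char_poly_power_sums[OF B] by blast
  have S: "set es \<subseteq> of_int ` S"
  proof
    fix e assume "e \<in> set es"
    then have "poly (char_poly ?B) e = 0"
      unfolding es(1) poly_prod_list by (auto simp: prod_list_zero_iff)
    then have "eigenvalue ?B e" using eigenvalue_root_char_poly[OF B] by simp
    then obtain v where v: "v \<in> carrier_vec n" "v \<noteq> 0\<^sub>v n" "?B *\<^sub>v v = e \<cdot>\<^sub>v v"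
      using B unfolding eigenvalue_def eigenvector_def by auto
    obtain i0 where "i0 < n" "v $ i0 \<noteq> 0" using v(1,2) by (auto simp: vec_eq_iff)
    moreover have "(\<Sum>k<n. complex_of_int (A $$ (i, k)) * v $ k) = e * v $ i" if "i < n" for i
      using arg_cong[OF v(3), of "\<lambda>u. u $ i"] A v(1) that
      by (simp add: scalar_prod_def lessThan_atLeast0)
    ultimately show "e \<in> of_int ` S" using spectrum by blast
  qed
  define c where "c y = count_list es (complex_of_int y)" for y
  have inj: "inj_on complex_of_int S" by (simp add: inj_on_def)
  have "(map_poly of_int (char_poly A) :: complex poly) = (\<Prod>e\<leftarrow>es. [:- e, 1:])"
    using es(1) unfolding of_int_hom.char_poly_hom[OF A] .
  also have "\<dots> = (\<Prod>y\<in>S. [:- of_int y, 1:] ^ c y)"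
    using prod_list_count_list[OF S, of "\<lambda>e. [:- e, 1:]"] fin
    by (simp add: prod.reindex[OF inj] c_def)
  also have "\<dots> = map_poly of_int (\<Prod>y\<in>S. [:- y, 1:] ^ c y)"
    by (simp add: of_int_poly_hom.hom_prod hom_distribs)
  finally have "char_poly A = (\<Prod>y\<in>S. [:- y, 1:] ^ c y)"
    by (simp only: of_int_poly_hom.eq_iff)
  moreover have "(\<Sum>i<n. (A ^\<^sub>m k) $$ (i, i)) = (\<Sum>y\<in>S. int (c y) * y ^ k)" for k
  proof -
    have "complex_of_int (\<Sum>i<n. (A ^\<^sub>m k) $$ (i, i)) = (\<Sum>i<n. (?B ^\<^sub>m k) $$ (i, i))"
      using A by (simp add: of_int_hom.mat_hom_pow[OF A, symmetric] pow_carrier_mat[OF A])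
    also have "\<dots> = (\<Sum>y\<in>S. of_nat (c y) * of_int y ^ k)"
      unfolding es(2) using sum_list_count_list[OF S, of "\<lambda>e. e ^ k"] fin
      by (simp add: sum.reindex[OF inj] c_def)
    also have "\<dots> = complex_of_int (\<Sum>y\<in>S. int (c y) * y ^ k)" by simp
    finally show ?thesis by (simp only: of_int_eq_iff)
  qed
  ultimately show ?thesis by blast
qed

section \<open>The spectrum of the Cayley graph\<close>

text \<open>Suitable combinations of the power sums evaluate a polynomial on the spectrum that
  vanishes at unwanted eigenvalues. This isolates \<open>n0\<close> and then \<open>n2\<close>; the
  sums of degree 0 and 1 leave a linear system for \<open>n1\<close> and \<open>n3\<close>.\<close>

lemma multiplicities_from_power_sums:
  fixes x :: int and n :: "nat \<Rightarrow> nat"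
  defines "N \<equiv> x ^ 3 - x" and "m \<equiv> x ^ 3 - x - x\<^sup>2"
  assumes x: "x > 2"
    and E0: "int n0 + int n1 + int n2 + int n3 = N"
    and E1: "int n0 * m + int n1 * x + int n2 * (- 1) + int n3 * (- x) = 0"
    and E2: "int n0 * m\<^sup>2 + int n1 * x\<^sup>2 + int n2 * (- 1)\<^sup>2 + int n3 * (- x)\<^sup>2 = N * m"
    and E3: "int n0 * m ^ 3 + int n1 * x ^ 3 + int n2 * (- 1) ^ 3 + int n3 * (- x) ^ 3
      = N * ((N - 2 * x\<^sup>2 + x + 1) * m - (N - x\<^sup>2 + 1) + (x + 1))"
  shows "n0 = 1" "2 * int n1 = x * (x - 1)\<^sup>2" "int n2 = x\<^sup>2" "2 * int n3 = (x - 2) * (x + 1)\<^sup>2"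
proof -
  have x1: "x\<^sup>2 - 1 > 0" using x one_less_power[of x 2] by simp
  have "x\<^sup>2 > 2 * x" using x by (simp add: power2_eq_square)
  \<comment> \<open>The product equals \<open>m - x\<close>, which is 0 at \<open>x = 2\<close>; the
    bound on \<open>x\<close> keeps the two largest eigenvalues apart.\<close>
  then have "x * (x\<^sup>2 - x - 2) > 0" using x by (intro mult_pos_pos) auto
  then have m: "m > x" unfolding m_def by (simp add: algebra_simps power2_eq_square power3_eq_cube)
  \<comment> \<open>The polynomial \<open>(y + 1) * (y^2 - x^2)\<close> vanishes at
    \<open>x\<close>, \<open>- 1\<close> and \<open>- x\<close>, so only the multiplicity of
    \<open>m\<close> survives.\<close>
  have "int n0 * ((m + 1) * ((m - x) * (m + x))) =
      (int n0 * m ^ 3 + int n1 * x ^ 3 + int n2 * (- 1) ^ 3 + int n3 * (- x) ^ 3)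
      + (int n0 * m\<^sup>2 + int n1 * x\<^sup>2 + int n2 * (- 1)\<^sup>2 + int n3 * (- x)\<^sup>2)
      - x\<^sup>2 * (int n0 * m + int n1 * x + int n2 * (- 1) + int n3 * (- x))
      - x\<^sup>2 * (int n0 + int n1 + int n2 + int n3)"
    by (simp add: algebra_simps power2_eq_square power3_eq_cube)
  also have "\<dots> = (m + 1) * ((m - x) * (m + x))"
    unfolding E0 E1 E2 E3 unfolding N_def m_def
    by (simp add: algebra_simps power2_eq_square power3_eq_cube)
  finally have "(int n0 - 1) * ((m + 1) * ((m - x) * (m + x))) = 0"
    by (simp add: left_diff_distrib)
  moreover have "(m + 1) * ((m - x) * (m + x)) \<noteq> 0" using m x by auto
  ultimately have n0: "int n0 = 1" by simp
  then show "n0 = 1" by simp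
  \<comment> \<open>The polynomial \<open>x^2 - y^2\<close> removes \<open>x\<close> and
    \<open>- x\<close>; the last summand corrects for the known contribution of \<open>m\<close> and
    for the expected value of \<open>n2\<close>.\<close>
  have "(int n2 - x\<^sup>2) * (x\<^sup>2 - 1) =
      x\<^sup>2 * (int n0 + int n1 + int n2 + int n3)
      - (int n0 * m\<^sup>2 + int n1 * x\<^sup>2 + int n2 * (- 1)\<^sup>2 + int n3 * (- x)\<^sup>2)
      + (m\<^sup>2 - x\<^sup>2 - x\<^sup>2 * (x\<^sup>2 - 1))"
    unfolding n0 by (simp add: algebra_simps)
  also have "\<dots> = 0"
    unfolding E0 E2 unfolding N_def m_def
    by (simp add: algebra_simps power2_eq_square power3_eq_cube)
  finally have "(int n2 - x\<^sup>2) * (x\<^sup>2 - 1) = 0" .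
  then show n2: "int n2 = x\<^sup>2" using x1 by simp
  have "x * (int n1 - int n3) = x * (2 * x + 1 - x\<^sup>2)"
    using E1 unfolding n0 n2 m_def by (simp add: algebra_simps power2_eq_square power3_eq_cube)
  then have diff: "int n1 - int n3 = 2 * x + 1 - x\<^sup>2" using x by simp
  have sum: "int n1 + int n3 = x ^ 3 - x - 1 - x\<^sup>2" using E0 n0 n2 unfolding N_def by linarith
  show "2 * int n1 = x * (x - 1)\<^sup>2" using diff sum
    by (simp add: algebra_simps power2_eq_square power3_eq_cube)
  show "2 * int n3 = (x - 2) * (x + 1)\<^sup>2" using diff sum
    by (simp add: algebra_simps power2_eq_square power3_eq_cube)
qed

section \<open>Quadratic relations for the adjacency matrix\<close>

context SL2_prime
begin

abbreviation quot :: "m2 \<Rightarrow> m2 \<Rightarrow> m2" where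
  "quot x y \<equiv> m2_mult p (m2_inv p x) y"

lemma quot_closed: "x \<in> SL2 p \<Longrightarrow> y \<in> SL2 p \<Longrightarrow> quot x y \<in> SL2 p"
  by (simp add: m2_mult_closed m2_inv_closed)

lemma unip_quot_sym: "unip p (quot x y) = unip p (quot y x)"
proof -
  obtain a b c d e f g h where xy: "x = (a, b, c, d)" "y = (e, f, g, h)"
    by (metis prod_cases4)
  have "d * e - b * g - c * f + a * h - 2 = h * a - f * c - g * b + e * d - 2" by simp
  then show ?thesis unfolding xy unip_inv_mult by (simp only:)
qed

text \<open>Exchanging \<open>x\<close> and \<open>y\<close> negates the determinant of
  \<open>x v\<close> and \<open>y v\<close> and so keeps its roots. The symmetry turns row sums into
  column sums.\<close>

lemma fixed_points_quot_sym: "fixed_points p (quot x y) = fixed_points p (quot y x)"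
proof -
  obtain a b c d e f g h where xy: "x = (a, b, c, d)" "y = (e, f, g, h)"
    by (metis prod_cases4)
  have neg: "form_roots q (- A) (- B) (- C) = form_roots q A B C" for q A B C
  proof -
    have "- A * X\<^sup>2 + - B * X * Y + - C * Y\<^sup>2 = - (A * X\<^sup>2 + B * X * Y + C * Y\<^sup>2)" for X Y
      by simp
    then show ?thesis unfolding form_roots_def by (simp only: dvd_minus_iff)
  qed
  have "e * c - g * a = - (a * g - c * e)" "f * d - h * b = - (b * h - d * f)"
    "e * d + f * c - g * b - h * a = - (a * h + b * g - c * f - d * e)" by simp_all
  then show ?thesis unfolding xy fixed_points_inv_mult by (simp only: neg)
qed

lemma sum_unip_row: "x \<in> SL2 p \<Longrightarrow> (\<Sum>h\<in>SL2 p. unip p (quot x h)) = (int p)\<^sup>2"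
  using sum_SL2_translate[of x "unip p"] by (simp add: sum_unip_1)

lemma sum_unip_col: "y \<in> SL2 p \<Longrightarrow> (\<Sum>h\<in>SL2 p. unip p (quot h y)) = (int p)\<^sup>2"
  using sum_unip_row by (simp only: unip_quot_sym[of _ y])

lemma sum_fixed_points_col:
  "y \<in> SL2 p \<Longrightarrow> (\<Sum>h\<in>SL2 p. fixed_points p (quot h y)) = int (card (SL2 p))"
  using sum_SL2_translate[of y "fixed_points p"]
  by (simp only: fixed_points_quot_sym[of _ y] sum_fixed_points)

definition adj :: "m2 \<Rightarrow> m2 \<Rightarrow> int" where
  "adj x y = 1 - unip p (quot x y)"

lemma adj_self: "x \<in> SL2 p \<Longrightarrow> adj x x = 0"
  by (simp add: adj_def m2_mult_inv unip_def)

lemma adj_row_sum: "x \<in> SL2 p \<Longrightarrow> (\<Sum>h\<in>SL2 p. adj x h) = int (card (SL2 p)) - (int p)\<^sup>2"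
  by (simp add: adj_def sum_subtractf sum_unip_row)

text \<open>Expanding \<open>(J - U)^2\<close>, the mixed terms are row and column sums of
  \<open>U\<close>, each equal to \<open>p^2\<close>, and \<open>U^2\<close> is the convolution of
  the unipotent indicator with itself.\<close>

lemma adj_square:
  assumes "x \<in> SL2 p" "y \<in> SL2 p"
  shows "(\<Sum>h\<in>SL2 p. adj x h * adj h y) = (int p)\<^sup>2 * of_bool (x = y)
    + (int (card (SL2 p)) - 2 * (int p)\<^sup>2 + int p + 1) - fixed_points p (quot x y)"
proof -
  have "(\<Sum>h\<in>SL2 p. adj x h * adj h y) = (\<Sum>h\<in>SL2 p. 1 - unip p (quot x h) - unip p (quot h y)
      + unip p (quot x h) * unip p (quot h y))"
    unfolding adj_def by (intro sum.cong) (simp_all add: algebra_simps)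
  also have "\<dots> = int (card (SL2 p)) - (int p)\<^sup>2 - (int p)\<^sup>2
      + ((int p)\<^sup>2 * of_bool (quot x y = m2_one) + int p + 1 - fixed_points p (quot x y))"
    unfolding sum.distrib sum_subtractf sum_unip_row[OF assms(1)] sum_unip_col[OF assms(2)]
      sum_SL2_convolution[OF assms(1)] unip_convolution_unip[OF quot_closed[OF assms]] by simp
  finally show ?thesis unfolding m2_inv_mult_eq_one_iff[OF assms] by simp
qed

lemma adj_fixed_points:
  assumes "x \<in> SL2 p" "y \<in> SL2 p"
  shows "(\<Sum>h\<in>SL2 p. adj x h * fixed_points p (quot h y)) =
    (int (card (SL2 p)) - (int p)\<^sup>2 + 1) - fixed_points p (quot x y)"
proof -
  have "(\<Sum>h\<in>SL2 p. adj x h * fixed_points p (quot h y)) = (\<Sum>h\<in>SL2 p. fixed_points p (quot h y)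
      - unip p (quot x h) * fixed_points p (quot h y))"
    unfolding adj_def by (intro sum.cong) (simp_all add: algebra_simps)
  then show ?thesis
    unfolding sum_subtractf sum_fixed_points_col[OF assms(2)] sum_SL2_convolution[OF assms(1)]
      unip_convolution_fixed_points[OF quot_closed[OF assms]] by simp
qed

section \<open>The connection set and the characteristic polynomial\<close>

lemma connT_eq: "connT p = {x \<in> SL2 p. unip p x = 0}"
  by (auto simp: connT_def unip_def)

lemma card_connT: "card (connT p) = card (SL2 p) - p\<^sup>2"
proof -
  have "int (card (connT p)) = (\<Sum>x\<in>SL2 p. of_bool (unip p x = 0))"
    unfolding connT_eq by (rule int_card_filter[OF finite_SL2])
  also have "\<dots> = (\<Sum>x\<in>SL2 p. 1 - unip p x)"
    by (intro sum.cong) (auto simp: unip_def)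
  also have "\<dots> = int (card (SL2 p)) - (int p)\<^sup>2"
    by (simp add: sum_subtractf sum_unip_1)
  \<comment> \<open>The left side is a cardinality, so the integer difference is nonnegative and
    agrees with truncated subtraction.\<close>
  finally show ?thesis by (simp add: nat_diff_distrib flip: of_nat_power)
qed

lemma char_poly_adj:
  assumes e: "bij_betw e {0..<card (SL2 p)} (SL2 p)"
  shows "char_poly (cayley_adj (SL2 p) (m2_mult p) (m2_inv p) (connT p) e) =
        [:- (int p * (int p^2 - 1) - int p^2), 1:]
      * [:- int p, 1:] ^ (p * (p - 1)^2 div 2)
      * [:1, 1:] ^ (p^2)
      * [:int p, 1:] ^ ((p - 2) * (p + 1)^2 div 2)"
proof -
  define n where "n = card (SL2 p)"
  define x where "x = int p"
  define N where "N = x ^ 3 - x"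
  define m where "m = x ^ 3 - x - x\<^sup>2"
  define s where "s = N - 2 * x\<^sup>2 + x + 1"
  define t where "t = N - x\<^sup>2 + 1"
  define A where "A = cayley_adj (SL2 p) (m2_mult p) (m2_inv p) (connT p) e"
  have nN: "int n = N" unfolding n_def N_def x_def by (rule card_SL2)
  have mN: "m = N - x\<^sup>2" by (simp add: m_def N_def)
  have A: "A \<in> carrier_mat n n" by (simp add: A_def cayley_adj_def n_def)
  have eG: "e i \<in> SL2 p" if "i < n" for i
    using e that unfolding bij_betw_def n_def by auto
  have e_eq: "e i = e j \<longleftrightarrow> i = j" if "i < n" "j < n" for i j
    using e that unfolding bij_betw_def n_def by (auto dest: inj_onD)
  have sum_e: "(\<Sum>k<n. f (e k)) = (\<Sum>h\<in>SL2 p. f h)" for f :: "m2 \<Rightarrow> int"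
    using sum.reindex_bij_betw[OF e, of f] by (simp add: n_def lessThan_atLeast0)
  have Aij: "A $$ (i, j) = adj (e i) (e j)" if "i < n" "j < n" for i j
  proof -
    have "quot (e i) (e j) \<in> SL2 p" using that eG quot_closed by blast
    then show ?thesis using that
      by (simp add: A_def cayley_adj_def n_def adj_def connT_eq unip_def)
  qed
  define P where "P i j = fixed_points p (quot (e i) (e j))" for i j
  have P_diag: "P i i = x + 1" if "i < n" for i
    using eG[OF that] fixed_points_one unfolding P_def m2_mult_inv(1)[OF eG[OF that]] x_def by blast
  have AA: "(\<Sum>k<n. A $$ (i, k) * A $$ (k, j)) = x\<^sup>2 * of_bool (i = j) + s - P i j"
    if "i < n" "j < n" for i j
  proof -
    have "(\<Sum>k<n. A $$ (i, k) * A $$ (k, j)) = (\<Sum>h\<in>SL2 p. adj (e i) h * adj h (e j))"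
      unfolding sum_e[symmetric] using that by (intro sum.cong) (auto simp: Aij)
    then show ?thesis
      unfolding adj_square[OF eG[OF that(1)] eG[OF that(2)]] e_eq[OF that] P_def s_def nN[symmetric]
      by (simp add: n_def x_def)
  qed
  have AP: "(\<Sum>k<n. A $$ (i, k) * P k j) = t - P i j" if "i < n" "j < n" for i j
  proof -
    have "(\<Sum>k<n. A $$ (i, k) * P k j) = (\<Sum>h\<in>SL2 p. adj (e i) h * fixed_points p (quot h (e j)))"
      unfolding sum_e[symmetric] P_def using that by (intro sum.cong) (auto simp: Aij)
    then show ?thesis
      unfolding adj_fixed_points[OF eG[OF that(1)] eG[OF that(2)]] P_def t_def nN[symmetric]
      by (simp add: n_def x_def)
  qed
  have A_row: "(\<Sum>k<n. A $$ (i, k)) = m" if "i < n" for i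
  proof -
    have "(\<Sum>k<n. A $$ (i, k)) = (\<Sum>h\<in>SL2 p. adj (e i) h)"
      unfolding sum_e[symmetric] using that by (intro sum.cong) (auto simp: Aij)
    then show ?thesis
      unfolding adj_row_sum[OF eG[OF that]] mN nN[symmetric] by (simp add: n_def x_def)
  qed
  have A_diag: "A $$ (i, i) = 0" if "i < n" for i
    using Aij[OF that that] adj_self[OF eG[OF that]] by simp
  have "\<exists>c. char_poly A = (\<Prod>y\<in>{m, x, - 1, - x}. [:- y, 1:] ^ c y) \<and>
    (\<forall>k. (\<Sum>i<n. (A ^\<^sub>m k) $$ (i, i)) = (\<Sum>y\<in>{m, x, - 1, - x}. int (c y) * y ^ k))"
  proof (rule int_char_poly_power_sums[OF A])
    fix ev i0 and v :: "nat \<Rightarrow> complex"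
    assume v: "i0 < n" "v i0 \<noteq> 0"
      "\<And>i. i < n \<Longrightarrow> (\<Sum>k<n. complex_of_int (A $$ (i, k)) * v k) = ev * v i"
    have "ev \<in> {complex_of_int m, complex_of_int x, - 1, - complex_of_int x}"
    proof (rule eigenvalue_of_quadratic_relations[where P = "\<lambda>i j. complex_of_int (P i j)"
          and s = "of_int s" and t = "of_int t", OF _ _ _ v(3) v(1,2)])
      fix i j assume ij: "i < n" "j < n"
      show "(\<Sum>k<n. complex_of_int (A $$ (i, k)) * complex_of_int (A $$ (k, j)))
          = (complex_of_int x)\<^sup>2 * of_bool (i = j) + of_int s - of_int (P i j)"
        using arg_cong[OF AA[OF ij], of complex_of_int] by simp
      show "(\<Sum>k<n. complex_of_int (A $$ (i, k)) * complex_of_int (P k j)) = of_int t - of_int (P i j)"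
        using arg_cong[OF AP[OF ij], of complex_of_int] by simp
    next
      fix i assume i: "i < n"
      show "(\<Sum>k<n. complex_of_int (A $$ (i, k))) = complex_of_int m"
        using arg_cong[OF A_row[OF i], of complex_of_int] by simp
    qed
    then show "ev \<in> complex_of_int ` {m, x, - 1, - x}" by auto
  qed simp
  then obtain c where cp: "char_poly A = (\<Prod>y\<in>{m, x, - 1, - x}. [:- y, 1:] ^ c y)"
    and power_sums: "(\<Sum>i<n. (A ^\<^sub>m k) $$ (i, i)) = (\<Sum>y\<in>{m, x, - 1, - x}. int (c y) * y ^ k)" for k
    by blast
  have A2: "(A * A) $$ (i, j) = x\<^sup>2 * of_bool (i = j) + s - P i j" if "i < n" "j < n" for i j
    using A that AA[OF that] by (simp add: scalar_prod_def lessThan_atLeast0)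
  \<comment> \<open>Multiplying the formula for the square by the matrix once more gives
    \<open>x^2 * A + s * m * J - A * P\<close>; on the diagonal the first term is 0 and
    \<open>P\<close> is \<open>x + 1\<close>.\<close>
  have A3: "(A * (A * A)) $$ (i, i) = s * m - t + (x + 1)" if i: "i < n" for i
  proof -
    have "(A * (A * A)) $$ (i, i) = (\<Sum>k<n. A $$ (i, k) * (A * A) $$ (k, i))"
      using A i by (simp add: scalar_prod_def lessThan_atLeast0)
    also have "\<dots> = (\<Sum>k<n. x\<^sup>2 * (if k = i then A $$ (i, k) else 0) + A $$ (i, k) * s - A $$ (i, k) * P k i)"
      using i by (intro sum.cong) (auto simp: A2 algebra_simps)
    also have "\<dots> = x\<^sup>2 * A $$ (i, i) + m * s - (t - P i i)"
      unfolding sum.distrib sum_subtractf AP[OF i i] sum_distrib_left[symmetric]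
        sum_distrib_right[symmetric] A_row[OF i] using i by simp
    finally show ?thesis using P_diag[OF i] A_diag[OF i] by (simp add: mult.commute)
  qed
  have E0: "(\<Sum>y\<in>{m, x, - 1, - x}. int (c y)) = N"
    using power_sums[of 0] A nN by simp
  have E1: "(\<Sum>y\<in>{m, x, - 1, - x}. int (c y) * y) = 0"
    using power_sums[of 1] A A_diag by simp
  have "(\<Sum>y\<in>{m, x, - 1, - x}. int (c y) * y ^ 2) = (\<Sum>i<n. (A * A) $$ (i, i))"
    using power_sums[of 2] A by (simp add: numeral_2_eq_2)
  \<comment> \<open>A diagonal entry of the square is the degree, since
    \<open>x^2 + s - (x + 1) = N - x^2\<close>.\<close>
  also have "\<dots> = (\<Sum>i<n. m)"
    using P_diag by (intro sum.cong) (auto simp: A2 s_def mN)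
  finally have E2: "(\<Sum>y\<in>{m, x, - 1, - x}. int (c y) * y ^ 2) = N * m"
    using nN by simp
  have "(\<Sum>y\<in>{m, x, - 1, - x}. int (c y) * y ^ 3) = (\<Sum>i<n. (A * (A * A)) $$ (i, i))"
    using power_sums[of 3] A by (simp add: numeral_3_eq_3 assoc_mult_mat[OF A A A])
  also have "\<dots> = N * (s * m - t + (x + 1))"
    using A3 nN by simp
  finally have E3: "(\<Sum>y\<in>{m, x, - 1, - x}. int (c y) * y ^ 3) = N * (s * m - t + (x + 1))" .
  have eigen0: "int p * ((int p)\<^sup>2 - 1) - (int p)\<^sup>2 = m"
    by (simp add: m_def x_def algebra_simps power2_eq_square power3_eq_cube)
  show ?thesis
  proof (cases "p = 2")
    case True
    \<comment> \<open>Now \<open>m\<close> and \<open>x\<close> coincide and only three candidates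
      remain, so three power sums suffice; the factors claimed for the first two eigenvalues merge
      into a square.\<close>
    then have x: "x = 2" "N = 6" "m = 2" by (simp_all add: x_def N_def m_def)
    have "c 2 = 2" "c (- 1) = 4" "c (- 2) = 0"
      using E0 E1 E2 unfolding x by simp_all
    then have "char_poly A = [:- 2, 1:]\<^sup>2 * [:1, 1:] ^ 4"
      unfolding cp x by simp
    then show ?thesis unfolding A_def eigen0 x(3) True by (simp add: power2_eq_square)
  next
    case False
    then have p: "p > 2" using prime_p prime_ge_2_nat[of p] by simp
    then have x: "x > 2" by (simp add: x_def)
    have "x\<^sup>2 > 2 * x" using x by (simp add: power2_eq_square)
    then have "x * (x\<^sup>2 - x - 2) > 0" using x by (intro mult_pos_pos) auto
    then have "m > x" unfolding m_def by (simp add: algebra_simps power2_eq_square power3_eq_cube)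
    then have distinct: "m \<notin> {x, - 1, - x}" "x \<notin> {- 1, - x}" "- 1 \<notin> {- x}" using x by auto
    have mult: "c m = 1" "2 * int (c x) = x * (x - 1)\<^sup>2" "int (c (- 1)) = x\<^sup>2"
      "2 * int (c (- x)) = (x - 2) * (x + 1)\<^sup>2"
      using multiplicities_from_power_sums[of x "c m" "c x" "c (- 1)" "c (- x)"]
        E0 E1 E2 E3 x distinct unfolding N_def m_def s_def t_def
      by (simp_all add: add.assoc)
    \<comment> \<open>The doubled equation shows that the product is even, so the division by 2 is
      exact.\<close>
    have "int (2 * c x) = int (p * (p - 1)\<^sup>2)"
      using mult(2) p by (simp add: x_def of_nat_diff)
    then have c1: "c x = p * (p - 1)\<^sup>2 div 2" by linarith
    have c2: "c (- 1) = p\<^sup>2" using mult(3) by (simp add: x_def flip: of_nat_power)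
    have "int (2 * c (- x)) = int ((p - 2) * (p + 1)\<^sup>2)"
      using mult(4) p by (simp add: x_def of_nat_diff)
    then have c3: "c (- x) = (p - 2) * (p + 1)\<^sup>2 div 2" by linarith
    have "char_poly A = [:- m, 1:] * [:- x, 1:] ^ c x * [:1, 1:] ^ c (- 1) * [:x, 1:] ^ c (- x)"
      unfolding cp using distinct mult(1)
      by (simp add: mult.assoc del: mult_pCons_left mult_pCons_right)
    then show ?thesis unfolding A_def eigen0 c1 c2 c3 unfolding x_def .
  qed
qed

end

theorem theorem4:
  fixes p :: nat and e :: "nat \<Rightarrow> m2"
  assumes "prime p"
    and "bij_betw e {0..<card (SL2 p)} (SL2 p)"
  shows "card (connT p) = card (SL2 p) - p^2
    \<and> char_poly (cayley_adj (SL2 p) (m2_mult p) (m2_inv p) (connT p) e) =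
        [:- (int p * (int p^2 - 1) - int p^2), 1:]
      * [:- int p, 1:] ^ (p * (p - 1)^2 div 2)
      * [:1, 1:] ^ (p^2)
      * [:int p, 1:] ^ ((p - 2) * (p + 1)^2 div 2)"
proof -
  interpret SL2_prime p by unfold_locales (rule assms(1))
  show ?thesis using card_connT char_poly_adj[OF assms(2)] by blast
qed

end
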